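(* Let $\omega$ be any pure translation invariant finitely correlated state on the chain with one-site algebra $\mathcal{A}=M_d(\mathbb{C})$, memory algebra $\mathcal{B}=M_b(\mathbb{C})$ and generating data $(V,\rho)$ (as described in the context). For integers $n\ge p\ge2$ let $\rho_{1,[p,n]}$ be the density matrix of the restriction of $\omega$ to the spins at sites $\{1\}\cup\{p,p+1,\dots,n\}$. Then there exist constants $C>0$ and $\mu\in(0,1)$, depending on the state but not on $p$ or $n$, such that with $\epsilon(p)=C\mu^p$, for all $n\ge p\ge2$, $$E_{[\mathcal{A},\mathcal{A}^{\otimes n-p+1}]}(\rho_{1,[p,n]})\;\le\;\epsilon(p),$$ where $E$ denotes the entanglement of formation and $\rho_{1,[p,n]}$ is regarded as a bipartite state of the spin at site $1$ versus the spins at sites $p,\dots,n$.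
   Context: Pure translation invariant finitely correlated states (FCS). Let $d,b\ge1$ be integers, $\mathcal{A}=M_d(\mathbb{C})$ (observables of one spin) and $\mathcal{B}=M_b(\mathbb{C})$ (the "memory"). Translation invariant states $\omega$ on the infinite chain $\mathcal{A}_{\mathbb{Z}}$ (the quasi-local limit of the algebras $\mathcal{A}^{\otimes(2n+1)}$ of sites $[-n,n]$) are determined by the density matrices $\rho_{[1,n]}$, $n\ge1$, of $n$ consecutive spins. A pure translation invariant FCS is given by the following data: - A linear map $V:\mathbb{C}^d\otimes\mathbb{C}^b\to\mathbb{C}^b$ with $VV^\dagger=\mathbf{1}_{\mathcal{B}}$. Set $\mathbb{E}(A\otimes B)=V(A\otimes B)V^\dagger$, a unital completely positive map $\mathcal{A}\otimes\mathcal{B}\to\mathcal{B}$, and $\hat{\mathbb{E}}(B)=\mathbb{E}(\mathbf{1}_{\mathcal{A}}\otimes B)$, a unital completely positive map $\mathcal{B}\to\mathcal{B}$. - A unique, non-singular $b\times b$ density matrix $\rho$ such that $\operatorname{Tr}(\rho\,\hat{\mathbb{E}}(B))=\operatorname{Tr}(\rho B)$ for all $B\in\mathcal{B}$. - The peripheral spectrum of $\hat{\mathbb{E}}$ is trivial: up to scalars, $\mathbf{1}_{\mathcal{B}}$ is the only eigenvector of $\hat{\mathbb{E}}$ with eigenvalue of modulus $1$ (a property of pure FCS). Consequently $\hat{\mathbb{E}}^n(B)\to\operatorname{Tr}(\rho B)\mathbf{1}_{\mathcal{B}}$ exponentially fast. The associated density matrices are $\rho_{\mathcal{A}\otimes\mathcal{B}}=V^\dagger\rho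 V$ on $\mathbb{C}^d\otimes\mathbb{C}^b$, and $$\rho_{[1,n]}=\operatorname{Tr}_{\mathcal{B}}(V_n^\dagger\,\rho_{\mathcal{A}\otimes\mathcal{B}}\,V_n),\qquad V_n=(\mathbf{1}_{\mathcal{A}}\otimes V)(\mathbf{1}_{\mathcal{A}^{\otimes2}}\otimes V)\cdots(\mathbf{1}_{\mathcal{A}^{\otimes n-1}}\otimes V),$$ where $V_n:(\mathbb{C}^d)^{\otimes n}\otimes\mathbb{C}^b\to\mathbb{C}^d\otimes\mathbb{C}^b$, $V_1$ is the identity, and $\operatorname{Tr}_{\mathcal{B}}$ is the partial trace over $\mathbb{C}^b$. The density matrix $\rho_{1,[p,n]}$ is the partial trace of $\rho_{[1,n]}$ over the sites $2,\dots,p-1$ (no trace is taken if $p=2$). Entanglement of formation. For a density matrix $\sigma_{12}$ of a bipartite system with observable algebra $\mathcal{X}_1\otimes\mathcal{X}_2$ (full matrix algebras), $$E_{[\mathcal{X}_1,\mathcal{X}_2]}(\sigma_{12})=\inf\sum_i p_i\,S\big(\operatorname{Tr}_{\mathcal{X}_2}(\sigma_{12}^i)\big),$$ where $S(\tau)=-\operatorname{Tr}\tau\log\tau$ (natural logarithm) and the infimum is over all convex decompositions $\sigma_{12}=\sum_i p_i\sigma_{12}^i$ into pure states $\sigma_{12}^i$ (rank-one projections). *)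

theory Defs
  imports
    "Jordan_Normal_Form.Schur_Decomposition"
    "Jordan_Normal_Form.DL_Rank"
begin

section \<open>Matrix preliminaries\<close>

definition mat_trace :: "'a :: comm_monoid_add mat \<Rightarrow> 'a" where
  "mat_trace A = (\<Sum>i<dim_row A. A $$ (i, i))"

text \<open>
  The basis vector \<open>e\<^sub>i \<otimes> e\<^sub>j\<close> of a tensor product whose right factor has dimension \<open>m\<close> has
  index \<open>i * m + j\<close>. Tensor powers follow the same convention, so the first site of a chain is the
  most significant digit and the memory is the least significant one.
\<close>

definition kron :: "'a :: times mat \<Rightarrow> 'a mat \<Rightarrow> 'a mat" where
  "kron A B = mat (dim_row A * dim_row B) (dim_col A * dim_col B)
     (\<lambda>(i, j). A $$ (i div dim_row B, j div dim_col B) * B $$ (i mod dim_row B, j mod dim_col B))"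

text \<open>Partial trace over the middle factor of a system of dimension \<open>k * m * l\<close>.\<close>

definition ptrace_mid :: "nat \<Rightarrow> nat \<Rightarrow> nat \<Rightarrow> 'a :: comm_monoid_add mat \<Rightarrow> 'a mat" where
  "ptrace_mid k m l X = mat (k * l) (k * l)
     (\<lambda>(i, j). \<Sum>s<m. X $$ (((i div l) * m + s) * l + i mod l, ((j div l) * m + s) * l + j mod l))"

text \<open>Partial trace over the right factor of a system of dimension \<open>k * m\<close>.\<close>

definition ptrace_right :: "nat \<Rightarrow> nat \<Rightarrow> 'a :: comm_monoid_add mat \<Rightarrow> 'a mat" where
  "ptrace_right k m X = mat k k (\<lambda>(i, j). \<Sum>s<m. X $$ (i * m + s, j * m + s))"

definition unitary_mat :: "nat \<Rightarrow> complex mat \<Rightarrow> bool" where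
  "unitary_mat n U \<longleftrightarrow> U \<in> carrier_mat n n \<and> U * mat_adjoint U = 1\<^sub>m n \<and> mat_adjoint U * U = 1\<^sub>m n"

definition density_mat :: "nat \<Rightarrow> complex mat \<Rightarrow> bool" where
  "density_mat n \<sigma> \<longleftrightarrow> \<sigma> \<in> carrier_mat n n \<and> mat_adjoint \<sigma> = \<sigma> \<and>
     (\<forall>v\<in>carrier_vec n. 0 \<le> (\<sigma> *\<^sub>v v) \<bullet>c v) \<and> mat_trace \<sigma> = 1"

definition pure_state :: "nat \<Rightarrow> complex mat \<Rightarrow> bool" where
  "pure_state n P \<longleftrightarrow> P \<in> carrier_mat n n \<and> mat_adjoint P = P \<and> P * P = P \<and> vec_space.rank n P = 1"


section \<open>Entropy and entanglement of formation\<close>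

text \<open>
  \<open>is_herm_fun f A B\<close>: \<open>B = f(A)\<close> in the functional calculus of the Hermitian matrix \<open>A\<close>, that is,
  \<open>A = U diag(l) U\<^sup>\<dagger>\<close> and \<open>B = U diag(f l) U\<^sup>\<dagger>\<close> for a unitary \<open>U\<close> and real \<open>l\<close>.
\<close>

definition is_herm_fun :: "(real \<Rightarrow> real) \<Rightarrow> complex mat \<Rightarrow> complex mat \<Rightarrow> bool" where
  "is_herm_fun f A B \<longleftrightarrow> (\<exists>U l. unitary_mat (dim_row A) U \<and>
     A = U * mat_diag (dim_row A) (\<lambda>i. complex_of_real (l i)) * mat_adjoint U \<and>
     B = U * mat_diag (dim_row A) (\<lambda>i. complex_of_real (f (l i))) * mat_adjoint U)"

lemma mat_adjoint_carrier:
  assumes "A \<in> carrier_mat n m"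
  shows "mat_adjoint A \<in> carrier_mat m n"
  using assms mat_of_rows_carrier(1)[of "dim_row A" "map conjugate (cols A)"]
  by (simp add: mat_adjoint_def)

lemma is_herm_fun_unique:
  assumes "is_herm_fun f A B" and "is_herm_fun f A B'"
  shows "B = B'"
proof -
  define n where "n = dim_row A"
  obtain U l where U: "unitary_mat n U"
    and A: "A = U * mat_diag n (\<lambda>i. complex_of_real (l i)) * mat_adjoint U"
    and B: "B = U * mat_diag n (\<lambda>i. complex_of_real (f (l i))) * mat_adjoint U"
    using assms(1) unfolding is_herm_fun_def n_def by blast
  obtain W k where W: "unitary_mat n W"
    and A': "A = W * mat_diag n (\<lambda>i. complex_of_real (k i)) * mat_adjoint W"
    and B': "B' = W * mat_diag n (\<lambda>i. complex_of_real (f (k i))) * mat_adjoint W"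
    using assms(2) unfolding is_herm_fun_def n_def by blast
  define U' where "U' = mat_adjoint U"
  define W' where "W' = mat_adjoint W"
  define M where "M = W' * U"
  have c[simp]: "U \<in> carrier_mat n n" "W \<in> carrier_mat n n" "U' \<in> carrier_mat n n"
    "W' \<in> carrier_mat n n" "M \<in> carrier_mat n n"
    using U W mat_adjoint_carrier[of _ n n]
    unfolding unitary_mat_def U'_def W'_def M_def by (auto intro!: mult_carrier_mat)
  note [simp] = left_mult_one_mat[of _ n n] right_mult_one_mat[of _ n n] mult_carrier_mat[of _ n n _ n]
  have u: "U * U' = 1\<^sub>m n" "U' * U = 1\<^sub>m n" "W * W' = 1\<^sub>m n" "W' * W = 1\<^sub>m n"
    using U W unfolding unitary_mat_def U'_def W'_def by auto
  have WM: "W * M = U"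
    using assoc_mult_mat[of W n n W' n U n] u unfolding M_def by (simp add: left_mult_one_mat[of U n n])
  have r: "(X * D * X') * Y = X * (D * (X' * Y))"
    if "X \<in> carrier_mat n n" "D \<in> carrier_mat n n" "X' \<in> carrier_mat n n" "Y \<in> carrier_mat n n"
    for X D X' Y :: "complex mat"
    using that by (simp add: assoc_mult_mat[of _ n n _ n _ n])
  have inv: "W' * (W * X) = X" if "X \<in> carrier_mat n n" for X
    using that assoc_mult_mat[of W' n n W n X n] u by simp
  let ?D = "mat_diag n (\<lambda>i. complex_of_real (l i))"
  let ?E = "mat_diag n (\<lambda>i. complex_of_real (k i))"
  let ?fD = "mat_diag n (\<lambda>i. complex_of_real (f (l i)))"
  let ?fE = "mat_diag n (\<lambda>i. complex_of_real (f (k i)))"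
  have "A * U = W * (?E * M)"
    unfolding A' W'_def[symmetric] M_def by (rule r) auto
  moreover have "A * U = U * ?D"
    unfolding A U'_def[symmetric] using r[of U ?D U' U] u by simp
  ultimately have "W * (?E * M) = W * (M * ?D)"
    using WM assoc_mult_mat[of W n n M n ?D n] by simp
  hence "W' * (W * (?E * M)) = W' * (W * (M * ?D))" by simp
  hence EM: "?E * M = M * ?D"
    by (simp add: inv mult_carrier_mat[of _ n n _ n])
  have entry: "complex_of_real (k i) * M $$ (i, j) = M $$ (i, j) * complex_of_real (l j)"
    if "i < n" "j < n" for i j
    using arg_cong[OF EM, of "\<lambda>X. X $$ (i, j)"] that
    by (simp add: mat_diag_mult_left[of M n n] mat_diag_mult_right[of M n n])
  have dM: "dim_row M = n" "dim_col M = n" using c(5) by blast+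
  have "?fE * M = M * ?fD"
  proof (rule eq_matI)
    fix i j assume "i < dim_row (M * ?fD)" "j < dim_col (M * ?fD)"
    hence ij: "i < n" "j < n" by (auto simp: mat_diag_def dM)
    have "M $$ (i, j) = 0 \<or> k i = l j" using entry[OF ij] by auto
    thus "(?fE * M) $$ (i, j) = (M * ?fD) $$ (i, j)"
      using ij by (auto simp: mat_diag_mult_left[of M n n] mat_diag_mult_right[of M n n])
  qed (auto simp: mat_diag_def dM)
  hence "W * (?fE * M) = W * M * ?fD"
    using assoc_mult_mat[of W n n M n ?fD n] by simp
  hence "B' * U = U * ?fD"
    unfolding B' W'_def[symmetric] using r[of W ?fE W' U] WM by (simp add: M_def)
  hence "B' * U * U' = B"
    unfolding B U'_def by simp
  moreover have "B' * U * U' = B'"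
    using assoc_mult_mat[of B' n n U n U' n] u mult_carrier_mat[of W n n ?fE n]
    unfolding B' W'_def[symmetric] by (simp add: mult_carrier_mat[of _ n n _ n])
  ultimately show ?thesis by simp
qed

definition herm_fun :: "(real \<Rightarrow> real) \<Rightarrow> complex mat \<Rightarrow> complex mat" where
  "herm_fun f A = (THE B. is_herm_fun f A B)"

text \<open>
  Von Neumann entropy \<open>- Tr \<tau> log \<tau>\<close>. On the kernel of \<open>\<tau>\<close> the product \<open>\<tau> log \<tau>\<close> vanishes, whatever
  value \<^term>\<open>ln (0 :: real)\<close> has, so that \<open>0 log 0 = 0\<close> as usual. The trace is real.
\<close>

definition vn_entropy :: "complex mat \<Rightarrow> real" where
  "vn_entropy \<tau> = - Re (mat_trace (\<tau> * herm_fun ln \<tau>))"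

text \<open>
  \<open>pure_decomposition n \<sigma> N q P\<close>: \<open>\<sigma> = (\<Sum>i<N. q i P i)\<close> is a convex combination of pure states. The
  sum is entrywise, since matrices of unspecified dimension do not form a monoid.
\<close>

definition pure_decomposition ::
    "nat \<Rightarrow> complex mat \<Rightarrow> nat \<Rightarrow> (nat \<Rightarrow> real) \<Rightarrow> (nat \<Rightarrow> complex mat) \<Rightarrow> bool" where
  "pure_decomposition n \<sigma> N q P \<longleftrightarrow>
     (\<forall>i<N. 0 \<le> q i \<and> pure_state n (P i)) \<and> (\<Sum>i<N. q i) = 1 \<and>
     \<sigma> = mat n n (\<lambda>rc. \<Sum>i<N. complex_of_real (q i) * P i $$ rc)"

text \<open>Entanglement of formation of a density matrix on \<open>\<complex>\<^sup>k \<otimes> \<complex>\<^sup>m\<close>.\<close>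

definition eof :: "nat \<Rightarrow> nat \<Rightarrow> complex mat \<Rightarrow> real" where
  "eof k m \<sigma> = Inf {(\<Sum>i<N. q i * vn_entropy (ptrace_right k m (P i))) | N q P.
     pure_decomposition (k * m) \<sigma> N q P}"


section \<open>Pure translation invariant finitely correlated states\<close>

text \<open>\<open>\<E>(X) = V X V\<^sup>\<dagger>\<close>, and its restriction \<open>B \<mapsto> \<E>(1 \<otimes> B)\<close> to the memory.\<close>

definition fcs_E :: "complex mat \<Rightarrow> complex mat \<Rightarrow> complex mat" where
  "fcs_E V X = V * X * mat_adjoint V"

definition fcs_Ehat :: "nat \<Rightarrow> complex mat \<Rightarrow> complex mat \<Rightarrow> complex mat" where
  "fcs_Ehat d V B = fcs_E V (kron (1\<^sub>m d) B)"

definition fcs_invariant :: "nat \<Rightarrow> nat \<Rightarrow> complex mat \<Rightarrow> complex mat \<Rightarrow> bool" where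
  "fcs_invariant d b V \<rho> \<longleftrightarrow>
     (\<forall>B\<in>carrier_mat b b. mat_trace (\<rho> * fcs_Ehat d V B) = mat_trace (\<rho> * B))"

locale pure_fcs =
  fixes d b :: nat and V \<rho> :: "complex mat"
  assumes d_ge_1: "d \<ge> 1" and b_ge_1: "b \<ge> 1"
    and V_carrier: "V \<in> carrier_mat b (d * b)"
    and V_coisometry: "V * mat_adjoint V = 1\<^sub>m b"
    and rho_density: "density_mat b \<rho>"
    and rho_nonsingular: "invertible_mat \<rho>"
    and rho_invariant: "fcs_invariant d b V \<rho>"
    and rho_unique: "\<And>\<rho>'. density_mat b \<rho>' \<Longrightarrow> fcs_invariant d b V \<rho>' \<Longrightarrow> \<rho>' = \<rho>"
    and peripheral_trivial:
      "\<And>B z. B \<in> carrier_mat b b \<Longrightarrow> B \<noteq> 0\<^sub>m b b \<Longrightarrow> cmod z = 1 \<Longrightarrow>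
         fcs_Ehat d V B = z \<cdot>\<^sub>m B \<Longrightarrow> \<exists>c. B = c \<cdot>\<^sub>m 1\<^sub>m b"

text \<open>\<open>V\<^sub>n = (1\<^bsub>d\<^esub> \<otimes> V) (1\<^bsub>d^2\<^esub> \<otimes> V) \<cdots> (1\<^bsub>d^(n-1)\<^esub> \<otimes> V)\<close>, an operator from \<open>\<complex>^(d^n * b)\<close> to \<open>\<complex>^(d * b)\<close>.\<close>

definition fcs_V :: "nat \<Rightarrow> nat \<Rightarrow> complex mat \<Rightarrow> nat \<Rightarrow> complex mat" where
  "fcs_V d b V n = foldl (*) (1\<^sub>m (d * b)) (map (\<lambda>k. kron (1\<^sub>m (d ^ k)) V) [1..<n])"

text \<open>The density matrix \<open>\<rho>\<^bsub>[1,n]\<^esub>\<close> of \<open>n\<close> consecutive spins.\<close>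

definition fcs_rho :: "nat \<Rightarrow> nat \<Rightarrow> complex mat \<Rightarrow> complex mat \<Rightarrow> nat \<Rightarrow> complex mat" where
  "fcs_rho d b V \<rho> n = ptrace_right (d ^ n) b
     (mat_adjoint (fcs_V d b V n) * (mat_adjoint V * \<rho> * V) * fcs_V d b V n)"

text \<open>
  The density matrix \<open>\<rho>\<^bsub>1,[p,n]\<^esub>\<close> of the spins at \<open>{1} \<union> {p..n}\<close>, for \<open>2 \<le> p \<le> n\<close>: the sites
  \<open>2, \<dots>, p - 1\<close> form a factor of dimension \<open>d ^ (p - 2)\<close>.
\<close>

definition fcs_rho_gap ::
    "nat \<Rightarrow> nat \<Rightarrow> complex mat \<Rightarrow> complex mat \<Rightarrow> nat \<Rightarrow> nat \<Rightarrow> complex mat" where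
  "fcs_rho_gap d b V \<rho> p n = ptrace_mid d (d ^ (p - 2)) (d ^ (n - p + 1)) (fcs_rho d b V \<rho> n)"

end

theory Submission
  imports Defs "Jordan_Normal_Form.Spectral_Radius"
begin

text \<open>
  Tracing out the \<open>k = p - 2\<close> sites of the gap applies \<open>k\<close> times to the memory the map dual to
  \<open>fcs_Ehat\<close>. Trivial peripheral spectrum makes this power converge exponentially to
  \<open>X \<mapsto> Tr(X) \<rho>\<close>, whose Choi matrix \<open>1 \<otimes> \<rho>\<close> is positive definite. Hence the power minus
  \<open>1 - \<epsilon>\<close> times the limit is completely positive with \<open>\<epsilon> = O(\<mu>\<^sup>k)\<close>, and gluing on both ends
  of the chain gives \<open>\<rho>\<^bsub>1,[p,n]\<^esub> = (1 - \<epsilon>) \<rho>\<^sub>1 \<otimes> \<rho>\<^bsub>[1,n-p+1]\<^esub> + \<epsilon> \<tau>\<close> for a state \<open>\<tau>\<close>. The product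
  state decomposes into product vectors, which have no entropy, and a pure state in the decomposition of
  \<open>\<tau>\<close> has entropy at most \<open>d\<close>, uniformly in \<open>n\<close>.
\<close>

section \<open>Unitary diagonalization\<close>

text \<open>The obstacle is uniformity in \<open>n\<close>: the right block has dimension
  \<open>d^(n-p+1)\<close>, and comparing matrix entries there would cost a factor growing with
  \<open>n\<close>. The comparison is therefore made between Choi kernels on the memory, where an
  entrywise error bounds a quadratic form at the fixed price \<open>b * b\<close>. It is stated as
  an operator inequality and not as a norm estimate, so that the error term is itself positive and
  has a decomposition of its own. Gluing is linear and preserves positivity, hence carries the
  inequality to the chain with the same weight. Nonsingularity of \<open>\<rho>\<close> makes this
  possible: the error is Hermitian of either sign, and it is absorbed by a multiple of a strictly
  positive form, bounded below through the smallest eigenvalue of \<open>\<rho>\<close>. Finally,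
  \<open>eof\<close> is an infimum of a set of reals, so a decomposition bounds it from above only
  once the set is known to be bounded below; this is the reason for the crude lower bounds on the
  entropy.\<close>

lemma mat_adjoint_index [simp]:
  fixes A :: "complex mat"
  assumes "i < dim_col A" "j < dim_row A"
  shows "mat_adjoint A $$ (i, j) = cnj (A $$ (j, i))"
  using assms by (simp add: mat_adjoint_def mat_of_rows_def)

lemma mat_adjoint_dim [simp]:
  "dim_row (mat_adjoint A) = dim_col A" "dim_col (mat_adjoint A) = dim_row A"
  by (simp_all add: mat_adjoint_def)

lemma mat_mult_index:
  assumes "A \<in> carrier_mat n k" "B \<in> carrier_mat k m" "i < n" "j < m"
  shows "(A * B) $$ (i, j) = (\<Sum>q<k. A $$ (i, q) * B $$ (q, j))"
  using assms by (auto simp: scalar_prod_def lessThan_atLeast0 intro!: sum.cong)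

lemma mat_adjoint_mult:
  fixes A B :: "complex mat"
  assumes A: "A \<in> carrier_mat n k" and B: "B \<in> carrier_mat k m"
  shows "mat_adjoint (A * B) = mat_adjoint B * mat_adjoint A"
proof (rule eq_matI)
  fix i j assume "i < dim_row (mat_adjoint B * mat_adjoint A)" "j < dim_col (mat_adjoint B * mat_adjoint A)"
  hence ij: "i < m" "j < n" using A B by auto
  have "mat_adjoint (A * B) $$ (i, j) = cnj ((A * B) $$ (j, i))"
    using ij A B by (intro mat_adjoint_index) auto
  also have "\<dots> = (\<Sum>q<k. mat_adjoint B $$ (i, q) * mat_adjoint A $$ (q, j))"
    unfolding mat_mult_index[OF A B ij(2,1)] cnj_sum using ij A B by (intro sum.cong) auto
  also have "\<dots> = (mat_adjoint B * mat_adjoint A) $$ (i, j)"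
    by (rule mat_mult_index[OF mat_adjoint_carrier[OF B] mat_adjoint_carrier[OF A] ij, symmetric])
  finally show "mat_adjoint (A * B) $$ (i, j) = (mat_adjoint B * mat_adjoint A) $$ (i, j)" .
qed (use A B in auto)

lemma mat_congruence_index:
  fixes M G :: "complex mat"
  assumes M: "M \<in> carrier_mat n n" and G: "G \<in> carrier_mat n m" and ij: "i < m" "j < m"
  shows "(mat_adjoint G * M * G) $$ (i, j) = (\<Sum>p<n. \<Sum>q<n. cnj (G $$ (p, i)) * M $$ (p, q) * G $$ (q, j))"
proof -
  note G' = mat_adjoint_carrier[OF G]
  have "(mat_adjoint G * M * G) $$ (i, j) = (\<Sum>q<n. (mat_adjoint G * M) $$ (i, q) * G $$ (q, j))"
    by (rule mat_mult_index[OF mult_carrier_mat[OF G' M] G ij])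
  also have "\<dots> = (\<Sum>q<n. \<Sum>p<n. cnj (G $$ (p, i)) * M $$ (p, q) * G $$ (q, j))"
  proof (rule sum.cong[OF refl])
    fix q assume "q \<in> {..<n}"
    hence q: "q < n" by simp
    show "(mat_adjoint G * M) $$ (i, q) * G $$ (q, j) =
        (\<Sum>p<n. cnj (G $$ (p, i)) * M $$ (p, q) * G $$ (q, j))"
      unfolding mat_mult_index[OF G' M ij(1) q] sum_distrib_right
      using ij G by (intro sum.cong) auto
  qed
  also have "\<dots> = (\<Sum>p<n. \<Sum>q<n. cnj (G $$ (p, i)) * M $$ (p, q) * G $$ (q, j))"
    by (rule sum.swap)
  finally show ?thesis .
qed

lemma unitary_mat_columns:
  assumes "unitary_mat n U" "i < n" "j < n"
  shows "(\<Sum>q<n. cnj (U $$ (q, i)) * U $$ (q, j)) = (if i = j then 1 else 0)"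
proof -
  have U: "U \<in> carrier_mat n n" and 1: "mat_adjoint U * U = 1\<^sub>m n"
    using assms(1) by (auto simp: unitary_mat_def)
  have "(mat_adjoint U * U) $$ (i, j) = (\<Sum>q<n. mat_adjoint U $$ (i, q) * U $$ (q, j))"
    by (rule mat_mult_index[OF mat_adjoint_carrier[OF U] U assms(2,3)])
  thus ?thesis using 1 assms U by auto
qed

lemma unitary_mat_rows:
  assumes "unitary_mat n U" "i < n" "j < n"
  shows "(\<Sum>q<n. U $$ (i, q) * cnj (U $$ (j, q))) = (if i = j then 1 else 0)"
proof -
  have U: "U \<in> carrier_mat n n" and 1: "U * mat_adjoint U = 1\<^sub>m n"
    using assms(1) by (auto simp: unitary_mat_def)
  have "(U * mat_adjoint U) $$ (i, j) = (\<Sum>q<n. U $$ (i, q) * mat_adjoint U $$ (q, j))"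
    by (rule mat_mult_index[OF U mat_adjoint_carrier[OF U] assms(2,3)])
  thus ?thesis using 1 assms U by auto
qed

lemma unitary_matI:
  assumes U: "U \<in> carrier_mat n n"
    and orth: "\<And>i j. i < n \<Longrightarrow> j < n \<Longrightarrow>
      (\<Sum>q<n. cnj (U $$ (q, i)) * U $$ (q, j)) = (if i = j then 1 else 0)"
  shows "unitary_mat n U"
proof -
  have "mat_adjoint U * U = 1\<^sub>m n"
  proof (rule eq_matI)
    fix i j assume "i < dim_row (1\<^sub>m n :: complex mat)" "j < dim_col (1\<^sub>m n :: complex mat)"
    hence ij: "i < n" "j < n" by auto
    show "(mat_adjoint U * U) $$ (i, j) = (1\<^sub>m n :: complex mat) $$ (i, j)"
      using orth[OF ij] ij U
      by (subst mat_mult_index[OF mat_adjoint_carrier[OF U] U ij]) auto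
  qed (use U in auto)
  thus ?thesis
    using mat_mult_left_right_inverse[OF mat_adjoint_carrier[OF U] U] U
    by (simp add: unitary_mat_def)
qed

lemma mat_diag_conjugation_index:
  assumes U: "U \<in> carrier_mat n n" and "i < n" "j < n"
  shows "(U * mat_diag n f * mat_adjoint U) $$ (i, j) =
    (\<Sum>q<n. U $$ (i, q) * f q * cnj (U $$ (j, q)))"
proof -
  have "(U * mat_diag n f * mat_adjoint U) $$ (i, j) =
      (\<Sum>q<n. (U * mat_diag n f) $$ (i, q) * mat_adjoint U $$ (q, j))"
    by (rule mat_mult_index[of _ n n]) (use assms mat_adjoint_carrier[OF U] in auto)
  also have "\<dots> = (\<Sum>q<n. U $$ (i, q) * f q * cnj (U $$ (j, q)))"
    using assms by (intro sum.cong) (auto simp: mat_diag_mult_right[OF U])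
  finally show ?thesis .
qed

lemma unitary_mat_mult:
  assumes "unitary_mat n U" "unitary_mat n W"
  shows "unitary_mat n (U * W)" 
proof (rule unitary_matI)
  have U: "U \<in> carrier_mat n n" and W: "W \<in> carrier_mat n n"
    using assms by (auto simp: unitary_mat_def)
  show "U * W \<in> carrier_mat n n" using U W by auto
  fix i j assume ij: "i < n" "j < n"
  have "(\<Sum>q<n. cnj ((U * W) $$ (q, i)) * (U * W) $$ (q, j)) =
      (\<Sum>q<n. \<Sum>r<n. \<Sum>s<n. cnj (W $$ (r, i)) * W $$ (s, j) * (cnj (U $$ (q, r)) * U $$ (q, s)))"
    using ij by (intro sum.cong refl)
      (simp add: mat_mult_index[OF U W] sum_product sum_distrib_left mult_ac)
  also have "\<dots> = (\<Sum>r<n. \<Sum>s<n. \<Sum>q<n. cnj (W $$ (r, i)) * W $$ (s, j) * (cnj (U $$ (q, r)) * U $$ (q, s)))"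
    by (subst sum.swap, rule sum.cong[OF refl], rule sum.swap)
  also have "\<dots> = (\<Sum>r<n. \<Sum>s<n. cnj (W $$ (r, i)) * W $$ (s, j) * (if r = s then 1 else 0))"
    using unitary_mat_columns[OF assms(1)]
    by (intro sum.cong refl) (simp add: sum_distrib_left[symmetric])
  also have "\<dots> = (\<Sum>r<n. cnj (W $$ (r, i)) * W $$ (r, j))"
    by (intro sum.cong refl) (simp add: if_distrib cong: if_cong)
  finally show "(\<Sum>q<n. cnj ((U * W) $$ (q, i)) * (U * W) $$ (q, j)) = (if i = j then 1 else 0)"
    using unitary_mat_columns[OF assms(2) ij] by simp
qed

text \<open>Complete \<open>v\<close> to a basis, orthogonalize, then normalize. Gram-Schmidt keeps
  the first vector, and the normalization accounts for the scalar \<open>c\<close>.\<close>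

lemma unitary_completion:
  fixes v :: "complex vec"
  assumes v: "v \<in> carrier_vec n" "v \<noteq> 0\<^sub>v n"
  shows "\<exists>U c. unitary_mat n U \<and> col U 0 = c \<cdot>\<^sub>v v"
proof -
  interpret cof_vec_space n "TYPE(complex)" .
  have n: "n > 0" using v by (cases n) auto
  define bs where "bs = basis_completion v"
  define ws where "ws = gram_schmidt n bs"
  note b = basis_completion[OF v, folded bs_def]
  note g = gram_schmidt_result[OF b(2,4,5) ws_def]
  have len: "length ws = n" using g b by simp
  have hd: "ws ! 0 = v"
  proof -
    obtain xs where "bs = v # xs" using b(6,7) n by (cases bs) auto
    hence "hd ws = v" using gram_schmidt_hd[OF v(1), of xs] by (simp add: ws_def)
    thus ?thesis using len n by (cases ws) auto
  qed
  have wsc: "ws ! i \<in> carrier_vec n" if "i < n" for i using g(3) len that by auto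
  have ip: "(ws ! j) \<bullet>c (ws ! i) = (\<Sum>q<n. cnj (ws ! i $ q) * ws ! j $ q)" if "i < n" "j < n" for i j
    using that by (auto simp: scalar_prod_def lessThan_atLeast0 mult.commute carrier_vecD[OF wsc]
      intro!: sum.cong)
  define s where "s i = (\<Sum>q<n. (cmod (ws ! i $ q))\<^sup>2)" for i
  have s: "complex_of_real (s i) = (\<Sum>q<n. cnj (ws ! i $ q) * ws ! i $ q)" for i
    unfolding s_def of_real_sum
    by (intro sum.cong refl) (simp add: complex_norm_square mult.commute del: of_real_power)
  have s0: "s i > 0" if "i < n" for i
  proof -
    have "s i \<noteq> 0"
      using corthogonalD[OF g(2), of i i] ip[OF that that] s[of i] len that by auto
    moreover have "s i \<ge> 0" unfolding s_def by (intro sum_nonneg) auto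
    ultimately show ?thesis by simp
  qed
  define U where "U = mat n n (\<lambda>(i, j). ws ! j $ i / complex_of_real (sqrt (s j)))"
  have "unitary_mat n U"
  proof (rule unitary_matI)
    fix i j assume ij: "i < n" "j < n"
    have "(\<Sum>q<n. cnj (U $$ (q, i)) * U $$ (q, j)) =
      (ws ! j \<bullet>c ws ! i) / (complex_of_real (sqrt (s i)) * complex_of_real (sqrt (s j)))"
      using ij by (simp add: U_def ip sum_divide_distrib)
    also have "\<dots> = (if i = j then 1 else 0)"
    proof (cases "i = j")
      case True
      have "complex_of_real (sqrt (s i)) * complex_of_real (sqrt (s i)) = complex_of_real (s i)"
        using s0[OF ij(1)] by (simp flip: of_real_mult)
      moreover have "ws ! j \<bullet>c ws ! i = complex_of_real (s i)"
        using True ip[OF ij] s[of i] by simp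
      ultimately show ?thesis using True s0[OF ij(1)] by simp
    next
      case False
      thus ?thesis using corthogonalD[OF g(2), of j i] len ij by simp
    qed
    finally show "(\<Sum>q<n. cnj (U $$ (q, i)) * U $$ (q, j)) = (if i = j then 1 else 0)" .
  qed (simp add: U_def)
  moreover have "col U 0 = (1 / complex_of_real (sqrt (s 0))) \<cdot>\<^sub>v v"
    using n v hd by (intro eq_vecI) (auto simp: U_def)
  ultimately show ?thesis by blast
qed

text \<open>Induction on the dimension. A unitary whose first column is an eigenvector turns
  \<open>A\<close> into a Hermitian matrix whose first column is \<open>e\<close> times a basis
  vector. By symmetry the first row has the same form, which leaves a Hermitian block of size
  \<open>n\<close>.\<close>

theorem hermitian_unitary_diagonalization:
  fixes A :: "complex mat"
  assumes "A \<in> carrier_mat n n" "mat_adjoint A = A"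
  shows "\<exists>U l. unitary_mat n U \<and> A = U * mat_diag n (\<lambda>i. complex_of_real (l i)) * mat_adjoint U"
  using assms
proof (induction n arbitrary: A)
  case 0
  have "unitary_mat 0 (1\<^sub>m 0)" by (rule unitary_matI) auto
  moreover have "A = 1\<^sub>m 0 * mat_diag 0 (\<lambda>i. complex_of_real 0) * mat_adjoint (1\<^sub>m 0)"
    using 0 by (intro eq_matI) (auto simp: mat_diag_def)
  ultimately show ?case by (intro exI[of _ "1\<^sub>m 0"] exI[of _ "\<lambda>_. 0"] conjI)
next
  case (Suc n)
  note A = Suc.prems(1)
  obtain e v where ev: "eigenvector A v e"
    using spectrum_non_empty[OF A] by (auto simp: spectrum_def eigenvalue_def)
  hence v: "v \<in> carrier_vec (Suc n)" "v \<noteq> 0\<^sub>v (Suc n)" and Av: "A *\<^sub>v v = e \<cdot>\<^sub>v v"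
    using A by (auto simp: eigenvector_def)
  obtain U c where un: "unitary_mat (Suc n) U" and col: "col U 0 = c \<cdot>\<^sub>v v"
    using unitary_completion[OF v] by blast
  have U: "U \<in> carrier_mat (Suc n) (Suc n)" using un by (simp add: unitary_mat_def)
  define U' where "U' = mat_adjoint U"
  have U': "U' \<in> carrier_mat (Suc n) (Suc n)" using U by (simp add: U'_def mat_adjoint_carrier)
  have uu: "U * U' = 1\<^sub>m (Suc n)" "U' * U = 1\<^sub>m (Suc n)" using un by (auto simp: unitary_mat_def U'_def)
  define B where "B = U' * A * U"
  have B: "B \<in> carrier_mat (Suc n) (Suc n)" using U U' A by (auto simp: B_def)
  have AB: "A = U * B * U'"
  proof -
    have "U * B * U' = (U * U') * A * (U * U')"
      using U U' A by (simp add: B_def assoc_mult_mat[of _ "Suc n" "Suc n" _ "Suc n" _ "Suc n"])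
    thus ?thesis using uu A by simp
  qed
  have Bsum: "B $$ (i, j) = (\<Sum>p<Suc n. \<Sum>q<Suc n. cnj (U $$ (p, i)) * A $$ (p, q) * U $$ (q, j))"
    if "i < Suc n" "j < Suc n" for i j
    unfolding B_def U'_def by (rule mat_congruence_index[OF A U that])
  have Aherm: "cnj (A $$ (p, q)) = A $$ (q, p)" if "p < Suc n" "q < Suc n" for p q
    using arg_cong[OF Suc.prems(2), of "\<lambda>X. X $$ (q, p)"] that A by auto
  have Bherm: "cnj (B $$ (i, j)) = B $$ (j, i)" if "i < Suc n" "j < Suc n" for i j
  proof -
    have "cnj (B $$ (i, j)) = (\<Sum>p<Suc n. \<Sum>q<Suc n. cnj (U $$ (q, j)) * A $$ (q, p) * U $$ (p, i))"
      unfolding Bsum[OF that] cnj_sum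
      by (intro sum.cong refl) (use Aherm in \<open>auto simp: mult_ac\<close>)
    also have "\<dots> = B $$ (j, i)" unfolding Bsum[OF that(2,1)] by (rule sum.swap)
    finally show ?thesis .
  qed
  have Bcol: "B $$ (i, 0) = (if i = 0 then e else 0)" if i: "i < Suc n" for i
  proof -
    have U0: "U $$ (q, 0) = c * v $ q" if "q < Suc n" for q
      using arg_cong[OF col, of "\<lambda>x. x $ q"] that U v by auto
    have Avp: "(\<Sum>q<Suc n. A $$ (p, q) * v $ q) = e * v $ p" if "p < Suc n" for p
      using arg_cong[OF Av, of "\<lambda>x. x $ p"] that A v
      by (auto simp: scalar_prod_def lessThan_atLeast0 simp del: sum.lessThan_Suc sum.op_ivl_Suc)
    have "B $$ (i, 0) = (\<Sum>p<Suc n. cnj (U $$ (p, i)) * (c * (\<Sum>q<Suc n. A $$ (p, q) * v $ q)))"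
      unfolding Bsum[OF i zero_less_Suc] sum_distrib_left
      by (intro sum.cong refl) (auto simp: U0 mult_ac)
    also have "\<dots> = (\<Sum>p<Suc n. e * (cnj (U $$ (p, i)) * U $$ (p, 0)))"
      by (intro sum.cong refl, subst Avp) (simp_all add: U0 del: sum.lessThan_Suc)
    also have "\<dots> = e * (if i = 0 then 1 else 0)"
      using unitary_mat_columns[OF un i zero_less_Suc]
      by (simp add: sum_distrib_left[symmetric] del: sum.lessThan_Suc)
    finally show ?thesis by simp
  qed
  have Brow: "B $$ (0, j) = (if j = 0 then e else 0)" if "j < Suc n" for j
    using Bherm[OF that zero_less_Suc] Bcol[OF that] Bcol[OF zero_less_Suc] by auto
  have e: "complex_of_real (Re e) = e"
    using Bherm[OF zero_less_Suc zero_less_Suc] Bcol[OF zero_less_Suc]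
    by (simp add: complex_eq_iff)
  define B2 where "B2 = mat n n (\<lambda>(i, j). B $$ (Suc i, Suc j))"
  have "mat_adjoint B2 = B2"
    by (rule eq_matI) (auto simp: B2_def Bherm)
  moreover have B2: "B2 \<in> carrier_mat n n" by (simp add: B2_def)
  ultimately obtain W l where W: "unitary_mat n W"
    and B2W: "B2 = W * mat_diag n (\<lambda>i. complex_of_real (l i)) * mat_adjoint W"
    using Suc.IH by blast
  have Wc: "W \<in> carrier_mat n n" using W by (simp add: unitary_mat_def)
  \<comment> \<open>The block sum of 1 and \<open>W\<close>; correspondingly \<open>k\<close>
    prepends the eigenvalue \<open>e\<close> to those of the smaller block.\<close>
  define X where "X = mat (Suc n) (Suc n) (\<lambda>(i, j). if i = 0 \<or> j = 0 then (if i = j then 1 else 0)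
    else W $$ (i - 1, j - 1))"
  define k where "k i = (case i of 0 \<Rightarrow> Re e | Suc i' \<Rightarrow> l i')" for i
  have Xc: "X \<in> carrier_mat (Suc n) (Suc n)" by (simp add: X_def)
  have X: "unitary_mat (Suc n) X"
  proof (rule unitary_matI[OF Xc])
    fix i j assume ij: "i < Suc n" "j < Suc n"
    show "(\<Sum>q<Suc n. cnj (X $$ (q, i)) * X $$ (q, j)) = (if i = j then 1 else 0)"
      unfolding sum.lessThan_Suc_shift using ij unitary_mat_columns[OF W, of "i - 1" "j - 1"]
      by (cases i; cases j) (auto simp: X_def)
  qed
  have BX: "B = X * mat_diag (Suc n) (\<lambda>i. complex_of_real (k i)) * mat_adjoint X"
  proof (rule eq_matI)
    fix i j assume "i < dim_row (X * mat_diag (Suc n) (\<lambda>i. complex_of_real (k i)) * mat_adjoint X)"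
      "j < dim_col (X * mat_diag (Suc n) (\<lambda>i. complex_of_real (k i)) * mat_adjoint X)"
    hence ij: "i < Suc n" "j < Suc n" using Xc by auto
    have B2ij: "B $$ (Suc i', Suc j') =
        (\<Sum>q<n. W $$ (i', q) * complex_of_real (l q) * cnj (W $$ (j', q)))" if "i' < n" "j' < n" for i' j'
      using mat_diag_conjugation_index[OF Wc that, of "\<lambda>i. complex_of_real (l i)"] that
      by (simp add: B2W[symmetric] B2_def)
    show "B $$ (i, j) = (X * mat_diag (Suc n) (\<lambda>i. complex_of_real (k i)) * mat_adjoint X) $$ (i, j)"
      unfolding mat_diag_conjugation_index[OF Xc ij] sum.lessThan_Suc_shift
      using ij Bcol[OF ij(1)] Brow[OF ij(2)]
      by (cases i; cases j) (auto simp: X_def k_def e B2ij)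
  qed (use B Xc in auto)
  let ?D = "mat_diag (Suc n) (\<lambda>i. complex_of_real (k i))"
  have adj: "mat_adjoint (U * X) = mat_adjoint X * U'"
    unfolding U'_def by (rule mat_adjoint_mult[OF U Xc])
  have "A = U * X * ?D * mat_adjoint (U * X)"
    unfolding adj unfolding AB BX using U U' Xc mat_adjoint_carrier[OF Xc]
    by (simp add: assoc_mult_mat[of _ "Suc n" "Suc n" _ "Suc n" _ "Suc n"]
      mult_carrier_mat[of _ "Suc n" "Suc n" _ "Suc n"])
  thus ?case using unitary_mat_mult[OF un X] by blast
qed

section \<open>Index arithmetic for flattened pairs\<close>

lemma sum_lessThan_add:
  fixes f :: "nat \<Rightarrow> 'a :: comm_monoid_add"
  shows "(\<Sum>i<m + n. f i) = (\<Sum>i<m. f i) + (\<Sum>j<n. f (m + j))"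
  by (induction n) (simp_all add: add.assoc)

lemma sum_lessThan_mult:
  fixes f :: "nat \<Rightarrow> 'a :: comm_monoid_add"
  shows "(\<Sum>i<m * n. f i) = (\<Sum>i<m. \<Sum>j<n. f (i * n + j))"
proof (induction m)
  case (Suc m)
  have "(\<Sum>i<Suc m * n. f i) = (\<Sum>i<m * n + n. f i)" by (simp add: add.commute)
  thus ?case using Suc by (simp add: sum_lessThan_add del: mult_Suc)
qed simp

lemma mult_add_less:
  fixes i j m n :: nat
  assumes "i < m" "j < n"
  shows "i * n + j < m * n"
proof -
  have "i * n + j < Suc i * n" using assms by simp
  also have "\<dots> \<le> m * n" using assms by (intro mult_le_mono1) simp
  finally show ?thesis .
qed

section \<open>Positive semidefinite kernels\<close>

text \<open>Positivity is stated for functions on an arbitrary index set, so that pairs and triples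
  of memory indices need no flattening. In the order on complex numbers, nonnegative includes real,
  which makes such a kernel Hermitian when \<open>I\<close> is finite.\<close>

definition psd :: "'i set \<Rightarrow> ('i \<Rightarrow> 'i \<Rightarrow> complex) \<Rightarrow> bool" where
  "psd I f \<longleftrightarrow> (\<forall>x. 0 \<le> (\<Sum>i\<in>I. \<Sum>j\<in>I. cnj (x i) * f i j * x j))"

lemma psd_eq:
  assumes "psd I f" "\<And>i j. i \<in> I \<Longrightarrow> j \<in> I \<Longrightarrow> f i j = g i j"
  shows "psd I g"
proof -
  have "(\<Sum>i\<in>I. \<Sum>j\<in>I. cnj (x i) * f i j * x j) = (\<Sum>i\<in>I. \<Sum>j\<in>I. cnj (x i) * g i j * x j)" for x
    using assms by (intro sum.cong refl) auto
  thus ?thesis using assms(1) by (simp add: psd_def)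
qed

lemma psd_outer: "psd I (\<lambda>i j. u i * cnj (u j))"
  unfolding psd_def
proof
  fix x
  define z where "z = (\<Sum>i\<in>I. cnj (x i) * u i)"
  have "(\<Sum>i\<in>I. \<Sum>j\<in>I. cnj (x i) * (u i * cnj (u j)) * x j) = z * cnj z"
    unfolding z_def cnj_sum sum_product by (intro sum.cong refl) (auto simp: mult_ac)
  also have "\<dots> = complex_of_real ((cmod z)\<^sup>2)" by (rule complex_norm_square[symmetric])
  finally show "0 \<le> (\<Sum>i\<in>I. \<Sum>j\<in>I. cnj (x i) * (u i * cnj (u j)) * x j)"
    by (simp add: less_eq_complex_def)
qed

lemma psd_sum:
  assumes "\<And>q. q \<in> Q \<Longrightarrow> psd I (f q)"
  shows "psd I (\<lambda>i j. \<Sum>q\<in>Q. f q i j)"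
  unfolding psd_def
proof
  fix x
  have "(\<Sum>i\<in>I. \<Sum>j\<in>I. cnj (x i) * (\<Sum>q\<in>Q. f q i j) * x j) =
      (\<Sum>i\<in>I. \<Sum>q\<in>Q. \<Sum>j\<in>I. cnj (x i) * f q i j * x j)"
    unfolding sum_distrib_left sum_distrib_right by (intro sum.cong refl sum.swap)
  also have "\<dots> = (\<Sum>q\<in>Q. \<Sum>i\<in>I. \<Sum>j\<in>I. cnj (x i) * f q i j * x j)" by (rule sum.swap)
  also have "0 \<le> \<dots>" using assms by (intro sum_nonneg[where A = Q]) (auto simp: psd_def)
  finally show "0 \<le> (\<Sum>i\<in>I. \<Sum>j\<in>I. cnj (x i) * (\<Sum>q\<in>Q. f q i j) * x j)" .
qed

lemma psd_scale:
  assumes "psd I f" "0 \<le> c"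
  shows "psd I (\<lambda>i j. complex_of_real c * f i j)"
  unfolding psd_def
proof
  fix x
  have "(\<Sum>i\<in>I. \<Sum>j\<in>I. cnj (x i) * (complex_of_real c * f i j) * x j) =
      complex_of_real c * (\<Sum>i\<in>I. \<Sum>j\<in>I. cnj (x i) * f i j * x j)"
    unfolding sum_distrib_left by (intro sum.cong refl) (auto simp: mult_ac)
  also have "0 \<le> \<dots>" using assms by (intro mult_nonneg_nonneg) (auto simp: psd_def less_eq_complex_def)
  finally show "0 \<le> (\<Sum>i\<in>I. \<Sum>j\<in>I. cnj (x i) * (complex_of_real c * f i j) * x j)" .
qed

text \<open>The form at \<open>x\<close> is the form of \<open>f\<close> at the vector
  \<open>g x\<close>, called \<open>y\<close> below.\<close>

lemma psd_congruence:
  assumes "psd I f"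
  shows "psd J (\<lambda>u v. \<Sum>i\<in>I. \<Sum>j\<in>I. cnj (g i u) * f i j * g j v)"
  unfolding psd_def
proof
  fix x
  define y where "y i = (\<Sum>u\<in>J. g i u * x u)" for i
  have "(\<Sum>u\<in>J. \<Sum>v\<in>J. cnj (x u) * (\<Sum>i\<in>I. \<Sum>j\<in>I. cnj (g i u) * f i j * g j v) * x v) =
      (\<Sum>u\<in>J. \<Sum>v\<in>J. \<Sum>i\<in>I. \<Sum>j\<in>I. (cnj (g i u) * cnj (x u)) * f i j * (g j v * x v))"
    unfolding sum_distrib_left sum_distrib_right by (intro sum.cong refl) (auto simp: mult_ac)
  also have "\<dots> = (\<Sum>u\<in>J. \<Sum>i\<in>I. \<Sum>v\<in>J. \<Sum>j\<in>I. (cnj (g i u) * cnj (x u)) * f i j * (g j v * x v))"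
    by (intro sum.cong refl sum.swap)
  also have "\<dots> = (\<Sum>i\<in>I. \<Sum>u\<in>J. \<Sum>v\<in>J. \<Sum>j\<in>I. (cnj (g i u) * cnj (x u)) * f i j * (g j v * x v))"
    by (rule sum.swap)
  also have "\<dots> = (\<Sum>i\<in>I. \<Sum>u\<in>J. \<Sum>j\<in>I. \<Sum>v\<in>J. (cnj (g i u) * cnj (x u)) * f i j * (g j v * x v))"
    by (intro sum.cong refl sum.swap)
  also have "\<dots> = (\<Sum>i\<in>I. \<Sum>j\<in>I. \<Sum>u\<in>J. \<Sum>v\<in>J. (cnj (g i u) * cnj (x u)) * f i j * (g j v * x v))"
    by (intro sum.cong refl sum.swap)
  also have "\<dots> = (\<Sum>i\<in>I. \<Sum>j\<in>I. cnj (y i) * f i j * y j)"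
    unfolding y_def
    by (intro sum.cong refl) (simp add: sum_distrib_left[symmetric] sum_distrib_right[symmetric])
  also have "0 \<le> \<dots>" using assms by (auto simp: psd_def)
  finally show "0 \<le> (\<Sum>u\<in>J. \<Sum>v\<in>J. cnj (x u) *
      (\<Sum>i\<in>I. \<Sum>j\<in>I. cnj (g i u) * f i j * g j v) * x v)" .
qed

text \<open>Congruence with the 0/1 matrix of \<open>h\<close>, which may repeat indices. This
  covers principal submatrices as well as the degenerate case \<open>i = j\<close> of
  polarization.\<close>

lemma psd_reindex:
  assumes "psd I f" "finite I" "h ` J \<subseteq> I"
  shows "psd J (\<lambda>u v. f (h u) (h v))"
proof -
  have "psd J (\<lambda>u v. \<Sum>i\<in>I. \<Sum>j\<in>I. cnj (if i = h u then 1 else 0) * f i j * (if j = h v then 1 else 0))"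
    by (rule psd_congruence[OF assms(1)])
  moreover have "(\<Sum>i\<in>I. \<Sum>j\<in>I. cnj (if i = h u then 1 else 0) * f i j * (if j = h v then 1 else 0))
      = f (h u) (h v)" if "u \<in> J" "v \<in> J" for u v
  proof -
    have "(\<Sum>i\<in>I. \<Sum>j\<in>I. cnj (if i = h u then 1 else 0) * f i j * (if j = h v then 1 else 0)) =
      (\<Sum>i\<in>I. \<Sum>j\<in>I. if j = h v then if i = h u then f i j else 0 else 0)"
      by (intro sum.cong refl) auto
    also have "\<dots> = (\<Sum>i\<in>I. if i = h u then f i (h v) else 0)"
      using that assms by (intro sum.cong refl) auto
    also have "\<dots> = f (h u) (h v)" using that assms by auto
    finally show ?thesis .
  qed
  ultimately show ?thesis by (rule psd_eq)
qed

lemma psd_diag: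
  assumes "psd I f" "finite I" "i \<in> I"
  shows "0 \<le> f i i"
proof -
  have "psd {()} (\<lambda>_ _. f i i)"
    using psd_reindex[OF assms(1,2), of "\<lambda>_. i" "{()}"] assms(3) by simp
  thus ?thesis unfolding psd_def by (rule allE[of _ "\<lambda>_. 1"]) simp
qed

text \<open>Polarization: the form is real, and testing it on the two points with coefficients 1, 1
  compares the imaginary parts of \<open>f i j\<close> and \<open>f j i\<close>, while coefficients
  1, \<open>\<i>\<close> compare the real parts.\<close>

lemma psd_hermitian:
  assumes "psd I f" "finite I" "i \<in> I" "j \<in> I"
  shows "f j i = cnj (f i j)"
proof -
  have "psd (UNIV :: bool set) (\<lambda>u v. f (if u then i else j) (if v then i else j))"
    using psd_reindex[OF assms(1,2), of "\<lambda>u. if u then i else j" UNIV] assms(3,4) by auto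
  hence q: "0 \<le> (\<Sum>u\<in>UNIV. \<Sum>v\<in>UNIV. cnj (x u) * f (if u then i else j) (if v then i else j) * x v)" for x
    by (auto simp: psd_def)
  have "Im (f i i) = 0" "Im (f j j) = 0"
    using psd_diag[OF assms(1,2)] assms(3,4) by (auto simp: less_eq_complex_def)
  moreover have "Im (f j j + f j i + (f i j + f i i)) = 0"
    using q[of "\<lambda>_. 1"] by (simp add: UNIV_bool less_eq_complex_def)
  moreover have "Im (f j j - \<i> * f j i + (f i j * \<i> + f i i)) = 0"
    using q[of "\<lambda>u. if u then 1 else \<i>"] by (simp add: UNIV_bool less_eq_complex_def)
  ultimately show ?thesis by (simp add: complex_eq_iff)
qed

text \<open>Two versions of the decomposition are kept: the matrix identity feeds the entropy, the
  entrywise one feeds ensembles of eigenvectors.\<close>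

lemma psd_spectral:
  assumes "psd {..<n} f"
  shows "\<exists>U l. unitary_mat n U \<and>
    mat n n (\<lambda>(i, j). f i j) = U * mat_diag n (\<lambda>i. complex_of_real (l i)) * mat_adjoint U \<and>
    (\<forall>i<n. \<forall>j<n. f i j = (\<Sum>q<n. U $$ (i, q) * complex_of_real (l q) * cnj (U $$ (j, q)))) \<and>
    (\<forall>q<n. 0 \<le> l q) \<and> (\<Sum>q<n. complex_of_real (l q)) = (\<Sum>i<n. f i i)"
proof -
  let ?A = "mat n n (\<lambda>(i, j). f i j)"
  have "mat_adjoint ?A = ?A"
    by (rule eq_matI) (auto intro!: psd_hermitian[OF assms, symmetric])
  then obtain U l where un: "unitary_mat n U"
    and A: "?A = U * mat_diag n (\<lambda>i. complex_of_real (l i)) * mat_adjoint U"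
    using hermitian_unitary_diagonalization[OF mat_carrier] by blast
  have U: "U \<in> carrier_mat n n" using un by (simp add: unitary_mat_def)
  have f: "f i j = (\<Sum>q<n. U $$ (i, q) * complex_of_real (l q) * cnj (U $$ (j, q)))"
    if "i < n" "j < n" for i j
    using mat_diag_conjugation_index[OF U that, of "\<lambda>i. complex_of_real (l i)"] that
    by (simp add: A[symmetric])
  \<comment> \<open>Testing the form on the \<open>p\<close>-th column of \<open>U\<close> isolates
    \<open>l p\<close>.\<close>
  have "0 \<le> l p" if p: "p < n" for p
  proof -
    have "(\<Sum>i<n. \<Sum>j<n. cnj (U $$ (i, p)) * f i j * U $$ (j, p)) =
      (\<Sum>i<n. \<Sum>j<n. \<Sum>q<n. complex_of_real (l q) *
        (cnj (U $$ (i, p)) * U $$ (i, q)) * (cnj (U $$ (j, q)) * U $$ (j, p)))"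
      by (intro sum.cong refl) (auto simp: f sum_distrib_left sum_distrib_right mult_ac)
    also have "\<dots> = (\<Sum>i<n. \<Sum>q<n. complex_of_real (l q) *
        (cnj (U $$ (i, p)) * U $$ (i, q)) * (\<Sum>j<n. cnj (U $$ (j, q)) * U $$ (j, p)))"
      unfolding sum_distrib_left by (intro sum.cong refl sum.swap)
    also have "\<dots> = (\<Sum>i<n. \<Sum>q<n. if q = p then complex_of_real (l q) *
        (cnj (U $$ (i, p)) * U $$ (i, q)) else 0)"
      using p by (intro sum.cong refl) (simp add: unitary_mat_columns[OF un])
    also have "\<dots> = (\<Sum>i<n. complex_of_real (l p) * (cnj (U $$ (i, p)) * U $$ (i, p)))"
      using p by (intro sum.cong refl) simp
    also have "\<dots> = complex_of_real (l p)"
      using unitary_mat_columns[OF un p p] by (simp add: sum_distrib_left[symmetric])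
    finally have "0 \<le> complex_of_real (l p)"
      using assms[unfolded psd_def, rule_format, of "\<lambda>i. U $$ (i, p)"] by (simp only:)
    thus ?thesis by (simp add: less_eq_complex_def)
  qed
  moreover have "(\<Sum>q<n. complex_of_real (l q)) = (\<Sum>i<n. f i i)"
  proof -
    have "(\<Sum>i<n. f i i) = (\<Sum>q<n. \<Sum>i<n. complex_of_real (l q) * (cnj (U $$ (i, q)) * U $$ (i, q)))"
      by (subst sum.swap, intro sum.cong refl) (auto simp: f mult_ac)
    also have "\<dots> = (\<Sum>q<n. complex_of_real (l q))"
      by (intro sum.cong refl) (auto simp: sum_distrib_left[symmetric] unitary_mat_columns[OF un])
    finally show ?thesis ..
  qed
  ultimately show ?thesis
    by (intro exI[of _ U] exI[of _ l] conjI allI impI un A f)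
qed

text \<open>Expanding \<open>f\<close> in eigenvectors makes the tensor kernel a nonnegative
  combination of congruences of \<open>g\<close>, one for each eigenvector; \<open>h q\<close> is
  the matrix of the \<open>q\<close>-th congruence.\<close>

lemma psd_tensor:
  fixes n :: nat and J :: "'a set"
  assumes "psd {..<n} f" "psd J g" "finite J"
  shows "psd ({..<n} \<times> J) (\<lambda>x y. f (fst x) (fst y) * g (snd x) (snd y))"
proof -
  obtain U l where f: "\<And>i j. i < n \<Longrightarrow> j < n \<Longrightarrow>
      f i j = (\<Sum>q<n. U $$ (i, q) * complex_of_real (l q) * cnj (U $$ (j, q)))"
    and l: "\<And>q. q < n \<Longrightarrow> 0 \<le> l q"
    using psd_spectral[OF assms(1)] by blast
  define h where "h q a x = (if a = snd x then cnj (U $$ (fst x, q)) else 0)" for q a and x :: "nat \<times> 'a"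
  have mix: "psd ({..<n} \<times> J) (\<lambda>x y. \<Sum>q\<in>{..<n}. complex_of_real (l q) *
      (\<Sum>a\<in>J. \<Sum>b\<in>J. cnj (h q a x) * g a b * h q b y))"
    using l by (intro psd_sum psd_scale psd_congruence assms) auto
  have h: "(\<Sum>a\<in>J. \<Sum>b\<in>J. cnj (h q a x) * g a b * h q b y) =
      U $$ (fst x, q) * g (snd x) (snd y) * cnj (U $$ (fst y, q))"
    if "x \<in> {..<n} \<times> J" "y \<in> {..<n} \<times> J" for x y q
  proof -
    have "(\<Sum>a\<in>J. \<Sum>b\<in>J. cnj (h q a x) * g a b * h q b y) =
      (\<Sum>a\<in>J. \<Sum>b\<in>J. if b = snd y then if a = snd x then
        U $$ (fst x, q) * g a b * cnj (U $$ (fst y, q)) else 0 else 0)"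
      by (intro sum.cong refl) (auto simp: h_def)
    also have "\<dots> = (\<Sum>a\<in>J. if a = snd x then U $$ (fst x, q) * g a (snd y) * cnj (U $$ (fst y, q)) else 0)"
      using that assms by (intro sum.cong refl) auto
    also have "\<dots> = U $$ (fst x, q) * g (snd x) (snd y) * cnj (U $$ (fst y, q))"
      using that assms by auto
    finally show ?thesis .
  qed
  show ?thesis
  proof (rule psd_eq[OF mix])
    fix x y assume xy: "x \<in> {..<n} \<times> J" "y \<in> {..<n} \<times> J"
    show "(\<Sum>q<n. complex_of_real (l q) * (\<Sum>a\<in>J. \<Sum>b\<in>J. cnj (h q a x) * g a b * h q b y)) =
        f (fst x) (fst y) * g (snd x) (snd y)"
      unfolding h[OF xy] using xy
      by (auto simp: f sum_distrib_right sum_distrib_left mult_ac intro!: sum.cong)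
  qed
qed

lemma density_mat_psd:
  assumes "density_mat n \<sigma>"
  shows "psd {..<n} (\<lambda>i j. \<sigma> $$ (i, j))"
  unfolding psd_def
proof
  fix x
  have s: "\<sigma> \<in> carrier_mat n n" and pos: "\<And>v. v \<in> carrier_vec n \<Longrightarrow> 0 \<le> (\<sigma> *\<^sub>v v) \<bullet>c v"
    using assms by (auto simp: density_mat_def)
  have "(\<sigma> *\<^sub>v vec n x) \<bullet>c vec n x = (\<Sum>i<n. \<Sum>j<n. cnj (x i) * \<sigma> $$ (i, j) * x j)"
    using s by (auto simp: scalar_prod_def lessThan_atLeast0 sum_distrib_left sum_distrib_right mult_ac
      intro!: sum.cong)
  thus "0 \<le> (\<Sum>i<n. \<Sum>j<n. cnj (x i) * \<sigma> $$ (i, j) * x j)"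
    using pos[of "vec n x"] by simp
qed

section \<open>Entropy\<close>

text \<open>\<open>herm_fun\<close> is a definite description, so its value comes from uniqueness:
  whichever diagonalization is at hand computes it.\<close>

lemma vn_entropy_spectral:
  assumes un: "unitary_mat n U"
    and A: "A = U * mat_diag n (\<lambda>i. complex_of_real (l i)) * mat_adjoint U"
  shows "vn_entropy A = - (\<Sum>i<n. l i * ln (l i))"
proof -
  have U: "U \<in> carrier_mat n n" and uu: "mat_adjoint U * U = 1\<^sub>m n"
    using un by (auto simp: unitary_mat_def)
  note U' = mat_adjoint_carrier[OF U]
  let ?D = "\<lambda>f. mat_diag n (\<lambda>i. complex_of_real (f (l i)))"
  have dim: "dim_row A = n" using U A by auto
  have "is_herm_fun ln A (U * ?D ln * mat_adjoint U)"
    unfolding is_herm_fun_def dim using un A by blast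
  hence hf: "herm_fun ln A = U * ?D ln * mat_adjoint U"
    unfolding herm_fun_def using is_herm_fun_unique by (intro the_equality) blast+
  have "A * herm_fun ln A = U * (?D (\<lambda>x. x) * (mat_adjoint U * U * (?D ln * mat_adjoint U)))"
    unfolding hf unfolding A using U U'
    by (simp add: assoc_mult_mat[of _ n n _ n _ n] mult_carrier_mat[of _ n n _ n])
  also have "\<dots> = U * (?D (\<lambda>x. x) * ?D ln) * mat_adjoint U"
    unfolding uu using U U'
    by (simp add: assoc_mult_mat[of _ n n _ n _ n] mult_carrier_mat[of _ n n _ n] left_mult_one_mat[of _ n n]
      del: mat_diag_diag)
  finally have e: "A * herm_fun ln A = U * mat_diag n (\<lambda>i. complex_of_real (l i * ln (l i))) * mat_adjoint U"
    by simp
  have "mat_trace (A * herm_fun ln A) =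
      (\<Sum>i<n. \<Sum>q<n. U $$ (i, q) * complex_of_real (l q * ln (l q)) * cnj (U $$ (i, q)))"
    unfolding e mat_trace_def using U
    by (auto simp: mat_diag_conjugation_index[OF U] simp del: of_real_mult index_mult_mat(1) intro!: sum.cong)
  also have "\<dots> = (\<Sum>q<n. complex_of_real (l q * ln (l q)) * (\<Sum>i<n. cnj (U $$ (i, q)) * U $$ (i, q)))"
    unfolding sum_distrib_left by (subst sum.swap) (auto simp: mult_ac intro!: sum.cong)
  also have "\<dots> = complex_of_real (\<Sum>q<n. l q * ln (l q))"
    by (simp add: unitary_mat_columns[OF un])
  finally show ?thesis by (simp add: vn_entropy_def)
qed

text \<open>From \<open>ln y \<le> y - 1\<close> at \<open>y = 1 / x\<close>. One unit per
  eigenvalue replaces the sharp logarithm of the dimension, which only affects the final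
  constant.\<close>

lemma minus_mult_ln_le_one: "- (x * ln x) \<le> 1" if "0 \<le> x" for x :: real
proof (cases "x = 0")
  case False
  hence x: "0 < x" using that by simp
  have "x * ln (1 / x) \<le> x * (1 / x - 1)"
    using x by (intro mult_left_mono ln_le_minus_one) auto
  thus ?thesis using x by (simp add: ln_div algebra_simps)
qed simp

lemma mult_ln_le: "x * ln x \<le> x\<^sup>2" if "0 \<le> x" for x :: real
proof (cases "x = 0")
  case False
  hence x: "0 < x" using that by simp
  have "x * ln x \<le> x * x"
    using x ln_le_minus_one[OF x] by (intro mult_left_mono) auto
  thus ?thesis by (simp add: power2_eq_square)
qed simp

lemma vn_entropy_le_dim:
  assumes "psd {..<n} f"
  shows "vn_entropy (mat n n (\<lambda>(i, j). f i j)) \<le> real n"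
proof -
  obtain U l where "unitary_mat n U"
    "mat n n (\<lambda>(i, j). f i j) = U * mat_diag n (\<lambda>i. complex_of_real (l i)) * mat_adjoint U"
    and l: "\<And>q. q < n \<Longrightarrow> 0 \<le> l q"
    using psd_spectral[OF assms] by blast
  hence "vn_entropy (mat n n (\<lambda>(i, j). f i j)) = (\<Sum>i<n. - (l i * ln (l i)))"
    using vn_entropy_spectral by (simp add: sum_negf)
  also have "\<dots> \<le> (\<Sum>i<n. 1)" using l by (intro sum_mono minus_mult_ln_le_one) auto
  finally show ?thesis by simp
qed

text \<open>Only the existence of a lower bound matters, for \<open>bdd_below_eof\<close>. The trace
  bounds each nonnegative eigenvalue by \<open>t\<close>, and \<open>x * ln x\<close> is at most the
  square of \<open>x\<close>.\<close>

lemma vn_entropy_ge: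
  assumes "psd {..<n} f" "Re (\<Sum>i<n. f i i) \<le> t"
  shows "- (real n * t\<^sup>2) \<le> vn_entropy (mat n n (\<lambda>(i, j). f i j))"
proof -
  obtain U l where "unitary_mat n U"
    "mat n n (\<lambda>(i, j). f i j) = U * mat_diag n (\<lambda>i. complex_of_real (l i)) * mat_adjoint U"
    and l: "\<And>q. q < n \<Longrightarrow> 0 \<le> l q"
    and tr: "(\<Sum>q<n. complex_of_real (l q)) = (\<Sum>i<n. f i i)"
    using psd_spectral[OF assms(1)] by blast
  hence S: "vn_entropy (mat n n (\<lambda>(i, j). f i j)) = - (\<Sum>i<n. l i * ln (l i))"
    using vn_entropy_spectral by simp
  have lt: "l q \<le> t" if "q < n" for q
  proof -
    have "l q \<le> (\<Sum>q<n. l q)" using l that by (intro member_le_sum) auto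
    also have "\<dots> = Re (\<Sum>q<n. complex_of_real (l q))" by simp
    finally show ?thesis using assms(2) tr by simp
  qed
  have "(\<Sum>i<n. l i * ln (l i)) \<le> (\<Sum>i<n. t\<^sup>2)"
    using l lt by (intro sum_mono order_trans[OF mult_ln_le] power_mono) auto
  thus ?thesis using S by simp
qed

text \<open>The eigenvalues of a projection are 0 and 1, and \<open>x * ln x\<close> vanishes at
  both.\<close>

lemma vn_entropy_idempotent:
  assumes "psd {..<n} f"
    and "\<And>i j. i < n \<Longrightarrow> j < n \<Longrightarrow> (\<Sum>q<n. f i q * f q j) = f i j"
  shows "vn_entropy (mat n n (\<lambda>(i, j). f i j)) = 0"
proof -
  let ?A = "mat n n (\<lambda>(i, j). f i j)"
  obtain U l where un: "unitary_mat n U" and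
    A: "?A = U * mat_diag n (\<lambda>i. complex_of_real (l i)) * mat_adjoint U"
    using psd_spectral[OF assms(1)] by blast
  have U: "U \<in> carrier_mat n n" and uu: "mat_adjoint U * U = 1\<^sub>m n"
    using un by (auto simp: unitary_mat_def)
  note U' = mat_adjoint_carrier[OF U]
  let ?D = "mat_diag n (\<lambda>i. complex_of_real (l i))"
  have AA: "?A * ?A = ?A"
  proof (rule eq_matI)
    fix i j assume "i < dim_row ?A" "j < dim_col ?A"
    hence ij: "i < n" "j < n" by auto
    show "(?A * ?A) $$ (i, j) = ?A $$ (i, j)"
      by (subst mat_mult_index[of _ n n _ n]) (use ij assms(2)[OF ij] in auto)
  qed auto
  note [simp] = assoc_mult_mat[of _ n n _ n _ n] mult_carrier_mat[of _ n n _ n]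
    left_mult_one_mat[of _ n n] right_mult_one_mat[of _ n n]
  have D: "mat_adjoint U * ?A * U = ?D"
  proof -
    have "mat_adjoint U * ?A * U = (mat_adjoint U * U) * ?D * (mat_adjoint U * U)"
      unfolding A using U U' by simp
    thus ?thesis unfolding uu by simp
  qed
  have "?D * ?D = mat_adjoint U * ?A * (U * mat_adjoint U) * ?A * U"
    unfolding D[symmetric] using U U' by simp
  also have "\<dots> = mat_adjoint U * (?A * ?A) * U"
    using un U U' by (simp add: unitary_mat_def)
  finally have DD: "?D * ?D = ?D" unfolding AA D .
  have "l q * ln (l q) = 0" if "q < n" for q
  proof -
    have "complex_of_real (l q) * complex_of_real (l q) = complex_of_real (l q)"
      using arg_cong[OF DD[unfolded mat_diag_diag], of "\<lambda>X. X $$ (q, q)"] that by (simp add: mat_diag_def)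
    hence "l q = 0 \<or> l q = 1" by auto
    thus ?thesis by auto
  qed
  hence "(\<Sum>q<n. l q * ln (l q)) = 0" by (intro sum.neutral) auto
  thus ?thesis using vn_entropy_spectral[OF un A] by simp
qed

section \<open>Entanglement of formation\<close>

definition outer :: "nat \<Rightarrow> (nat \<Rightarrow> complex) \<Rightarrow> complex mat" where
  "outer n u = mat n n (\<lambda>(i, j). u i * cnj (u j))"

lemma pure_state_outer:
  assumes norm: "(\<Sum>i<n. u i * cnj (u i)) = 1"
  shows "pure_state n (outer n u)"
proof -
  interpret vec_space "TYPE(complex)" n .
  let ?P = "outer n u"
  have P: "?P \<in> carrier_mat n n" by (simp add: outer_def)
  have adj: "mat_adjoint ?P = ?P" by (rule eq_matI) (auto simp: outer_def)
  have PP: "?P * ?P = ?P"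
  proof (rule eq_matI)
    fix i j assume "i < dim_row ?P" "j < dim_col ?P"
    hence ij: "i < n" "j < n" by (auto simp: outer_def)
    have "(?P * ?P) $$ (i, j) = (\<Sum>q<n. u i * cnj (u j) * (u q * cnj (u q)))"
      unfolding mat_mult_index[OF P P ij] using ij by (intro sum.cong) (auto simp: outer_def)
    also have "\<dots> = u i * cnj (u j)" by (simp add: sum_distrib_left[symmetric] norm)
    finally show "(?P * ?P) $$ (i, j) = ?P $$ (i, j)" using ij by (simp add: outer_def)
  qed (use P in auto)
  have "rank ?P \<le> 1"
    by (rule rank_le_1_product_entries[OF P, of u "\<lambda>j. cnj (u j)"]) (auto simp: outer_def)
  \<comment> \<open>The norm condition forces some \<open>u j\<close> to be nonzero, so column
    \<open>j\<close> is nonzero; it belongs to a completed basis and is therefore linearly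
    independent.\<close>
  moreover have "1 \<le> rank ?P"
  proof -
    obtain j where j: "j < n" "u j \<noteq> 0"
      using norm by (metis (no_types, lifting) lessThan_iff mult_zero_left sum.neutral zero_neq_one)
    have v: "col ?P j \<in> carrier_vec n" using col_dim[of ?P j] by (simp add: outer_def)
    have "col ?P j $ j \<noteq> 0" using j by (simp add: outer_def)
    hence v0: "col ?P j \<noteq> 0\<^sub>v n" using j by auto
    note b = basis_completion[OF v v0]
    have "col ?P j \<in> set (basis_completion (col ?P j))"
      using b(6,7) j by (metis hd_in_set length_greater_0_conv less_nat_zero_code neq0_conv)
    hence "lin_indpt {col ?P j}" by (intro subset_li_is_li[OF b(5)]) auto
    moreover have "{col ?P j} \<subseteq> set (cols ?P)"
      using j by (auto simp: cols_def outer_def)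
    ultimately show ?thesis using rank_ge_card_indpt[OF P, of "{col ?P j}"] by simp
  qed
  ultimately show ?thesis using P adj PP by (simp add: pure_state_def)
qed

text \<open>A partial trace is a sum of principal submatrices, one for each basis vector of the
  traced factor.\<close>

lemma psd_ptrace_right:
  fixes k m :: nat
  assumes "psd {..<k * m} f"
  shows "psd {..<k} (\<lambda>i j. \<Sum>s<m. f (i * m + s) (j * m + s))"
proof (rule psd_sum)
  fix s assume "s \<in> {..<m}"
  thus "psd {..<k} (\<lambda>i j. f (i * m + s) (j * m + s))"
    by (intro psd_reindex[OF assms finite_lessThan, of "\<lambda>i. i * m + s" "{..<k}"])
      (auto simp: mult_add_less)
qed

lemma ptrace_right_eq:
  assumes "X \<in> carrier_mat (k * m) (k * m)" "\<And>i j. i < k * m \<Longrightarrow> j < k * m \<Longrightarrow> X $$ (i, j) = f i j"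
  shows "ptrace_right k m X = mat k k (\<lambda>(i, j). \<Sum>s<m. f (i * m + s) (j * m + s))"
  unfolding ptrace_right_def using assms
  by (intro eq_matI) (auto intro!: sum.cong simp: mult_add_less)

text \<open>A Hermitian idempotent is \<open>P\<close> times its adjoint, hence positive, and its
  diagonal entries are at most 1. So the trace is at most the dimension, which suffices for a lower
  bound.\<close>

lemma pure_state_entropy_ge:
  assumes "pure_state (k * m) P"
  shows "- (real k * (real (k * m))\<^sup>2) \<le> vn_entropy (ptrace_right k m P)"
proof -
  have P: "P \<in> carrier_mat (k * m) (k * m)" and adj: "mat_adjoint P = P" and PP: "P * P = P"
    using assms by (auto simp: pure_state_def)
  have herm: "P $$ (i, j) = cnj (P $$ (j, i))" if "i < k * m" "j < k * m" for i j
    using arg_cong[OF adj, of "\<lambda>X. X $$ (i, j)"] that P by auto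
  have sq: "P $$ (i, j) = (\<Sum>q<k * m. P $$ (i, q) * cnj (P $$ (j, q)))"
    if "i < k * m" "j < k * m" for i j
  proof -
    have "P $$ (i, j) = (\<Sum>q<k * m. P $$ (i, q) * P $$ (q, j))"
      using mat_mult_index[OF P P that] by (simp add: PP)
    also have "\<dots> = (\<Sum>q<k * m. P $$ (i, q) * cnj (P $$ (j, q)))"
      using that by (intro sum.cong refl arg_cong2[of _ _ _ _ "(*)"] herm) auto
    finally show ?thesis .
  qed
  have psdP: "psd {..<k * m} (\<lambda>i j. P $$ (i, j))"
  proof (rule psd_eq)
    show "psd {..<k * m} (\<lambda>i j. \<Sum>q<k * m. P $$ (i, q) * cnj (P $$ (j, q)))"
      by (intro psd_sum psd_outer)
  qed (auto intro!: sq[symmetric])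
  \<comment> \<open>A diagonal entry of \<open>P\<close> is the sum of the squared moduli of its
    row, in particular at least its own square.\<close>
  have diag: "Re (P $$ (i, i)) \<le> 1" if i: "i < k * m" for i
  proof -
    have "P $$ (i, i) = (\<Sum>q<k * m. complex_of_real ((cmod (P $$ (i, q)))\<^sup>2))"
      unfolding complex_norm_square by (rule sq[OF i i])
    hence re: "Re (P $$ (i, i)) = (\<Sum>q<k * m. (cmod (P $$ (i, q)))\<^sup>2)" by simp
    have "(Re (P $$ (i, i)))\<^sup>2 \<le> (cmod (P $$ (i, i)))\<^sup>2" by (simp add: cmod_power2)
    also have "\<dots> \<le> (\<Sum>q<k * m. (cmod (P $$ (i, q)))\<^sup>2)"
      using i by (intro member_le_sum) auto
    finally have "Re (P $$ (i, i)) * Re (P $$ (i, i)) \<le> Re (P $$ (i, i)) * 1"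
      by (simp add: re power2_eq_square)
    thus ?thesis unfolding mult_le_cancel_left by linarith
  qed
  have "Re (\<Sum>i<k. \<Sum>s<m. P $$ (i * m + s, i * m + s)) = (\<Sum>i<k * m. Re (P $$ (i, i)))"
    by (simp add: sum_lessThan_mult)
  also have "\<dots> \<le> (\<Sum>i<k * m. 1)" using diag by (intro sum_mono) auto
  finally have "Re (\<Sum>i<k. \<Sum>s<m. P $$ (i * m + s, i * m + s)) \<le> real (k * m)" by simp
  from vn_entropy_ge[OF psd_ptrace_right[OF psdP] this] show ?thesis
    unfolding ptrace_right_def .
qed

text \<open>Needed for \<open>cInf_lower\<close>. The weights sum to 1, so a bound valid for each
  pure state is valid for every average.\<close>

lemma bdd_below_eof:
  "bdd_below {(\<Sum>i<N. q i * vn_entropy (ptrace_right k m (P i))) | N q P.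
     pure_decomposition (k * m) \<sigma> N q P}"
proof (rule bdd_belowI)
  let ?c = "- (real k * (real (k * m))\<^sup>2)"
  fix x assume "x \<in> {(\<Sum>i<N. q i * vn_entropy (ptrace_right k m (P i))) | N q P.
     pure_decomposition (k * m) \<sigma> N q P}"
  then obtain N q P where x: "x = (\<Sum>i<N. q i * vn_entropy (ptrace_right k m (P i)))"
    and dec: "pure_decomposition (k * m) \<sigma> N q P" by blast
  have "?c = (\<Sum>i<N. q i * ?c)"
    using dec by (simp only: pure_decomposition_def sum_distrib_right[symmetric] mult_1)
  also have "\<dots> \<le> x"
    unfolding x using dec
    by (intro sum_mono mult_left_mono pure_state_entropy_ge) (auto simp: pure_decomposition_def)
  finally show "?c \<le> x" .
qed

lemma vn_entropy_outer:
  assumes "(\<Sum>i<n. u i * cnj (u i)) = 1"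
  shows "vn_entropy (outer n u) = 0"
  unfolding outer_def
proof (rule vn_entropy_idempotent[OF psd_outer])
  fix i j
  have "(\<Sum>q<n. u i * cnj (u q) * (u q * cnj (u j))) = (\<Sum>q<n. u i * cnj (u j) * (u q * cnj (u q)))"
    by (intro sum.cong refl) simp
  thus "(\<Sum>q<n. u i * cnj (u q) * (u q * cnj (u j))) = u i * cnj (u j)"
    by (simp add: sum_distrib_left[symmetric] assms)
qed

text \<open>The bound depends on the first factor alone, because a reduced state has size
  \<open>k\<close> whatever \<open>m\<close> is.\<close>

lemma eof_mixture_with_product_le:
  fixes \<epsilon> :: real
  assumes \<alpha>: "psd {..<k} \<alpha>" "(\<Sum>i<k. \<alpha> i i) = 1"
    and \<beta>: "psd {..<m} \<beta>" "(\<Sum>i<m. \<beta> i i) = 1"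
    and \<tau>: "psd {..<k * m} \<tau>" "(\<Sum>i<k * m. \<tau> i i) = 1"
    and \<epsilon>: "0 \<le> \<epsilon>" "\<epsilon> \<le> 1"
  shows "eof k m (mat (k * m) (k * m) (\<lambda>(i, j).
    complex_of_real (1 - \<epsilon>) * (\<alpha> (i div m) (j div m) * \<beta> (i mod m) (j mod m)) +
    complex_of_real \<epsilon> * \<tau> i j)) \<le> \<epsilon> * real k" (is "eof k m ?\<omega> \<le> _")
proof -
  obtain U a where U: "unitary_mat k U"
    and \<alpha>_eq: "\<And>i j. i < k \<Longrightarrow> j < k \<Longrightarrow>
      \<alpha> i j = (\<Sum>q<k. U $$ (i, q) * complex_of_real (a q) * cnj (U $$ (j, q)))"
    and a: "\<And>q. q < k \<Longrightarrow> 0 \<le> a q" and a1: "(\<Sum>q<k. complex_of_real (a q)) = 1"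
    using psd_spectral[OF \<alpha>(1)] unfolding \<alpha>(2) by blast
  obtain W b where W: "unitary_mat m W"
    and \<beta>_eq: "\<And>i j. i < m \<Longrightarrow> j < m \<Longrightarrow>
      \<beta> i j = (\<Sum>q<m. W $$ (i, q) * complex_of_real (b q) * cnj (W $$ (j, q)))"
    and b: "\<And>q. q < m \<Longrightarrow> 0 \<le> b q" and b1: "(\<Sum>q<m. complex_of_real (b q)) = 1"
    using psd_spectral[OF \<beta>(1)] unfolding \<beta>(2) by blast
  obtain X t where X: "unitary_mat (k * m) X"
    and \<tau>_eq: "\<And>i j. i < k * m \<Longrightarrow> j < k * m \<Longrightarrow>
      \<tau> i j = (\<Sum>q<k * m. X $$ (i, q) * complex_of_real (t q) * cnj (X $$ (j, q)))"
    and t: "\<And>q. q < k * m \<Longrightarrow> 0 \<le> t q" and t1: "(\<Sum>q<k * m. complex_of_real (t q)) = 1"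
    using psd_spectral[OF \<tau>(1)] unfolding \<tau>(2) by blast
  have a1': "(\<Sum>q<k. a q) = 1" and b1': "(\<Sum>q<m. b q) = 1" and t1': "(\<Sum>q<k * m. t q) = 1"
    using a1 b1 t1 by (simp_all flip: of_real_sum)
  define N where "N = k * m + k * m"
  \<comment> \<open>Indices below \<open>k * m\<close> enumerate pairs of eigenvectors of
    \<open>\<alpha>\<close> and \<open>\<beta>\<close>; the next \<open>k * m\<close> indices
    enumerate the eigenvectors of \<open>\<tau>\<close>.\<close>
  define w where "w s = (if s < k * m then (1 - \<epsilon>) * (a (s div m) * b (s mod m)) else \<epsilon> * t (s - k * m))" for s
  define u where "u s i = (if s < k * m then U $$ (i div m, s div m) * W $$ (i mod m, s mod m)
    else X $$ (i, s - k * m))" for s i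
  have split: "s div m < k" "s mod m < m" if "s < k * m" for s
    using that by (auto simp: less_mult_imp_div_less) (cases m; simp)
  have w0: "0 \<le> w s" if "s < N" for s
    using that \<epsilon> a b t split by (auto simp: w_def N_def)
  have w1: "(\<Sum>s<N. w s) = 1"
  proof -
    have "(\<Sum>s<k * m. w s) = (\<Sum>p<k. \<Sum>q<m. (1 - \<epsilon>) * (a p * b q))"
      unfolding sum_lessThan_mult by (intro sum.cong refl) (auto simp: w_def mult_add_less)
    also have "\<dots> = 1 - \<epsilon>"
      by (simp add: sum_distrib_left[symmetric] sum_distrib_right[symmetric] a1' b1')
    finally have "(\<Sum>s<k * m. w s) = 1 - \<epsilon>" .
    moreover have "(\<Sum>s<k * m. w (k * m + s)) = \<epsilon>"
      by (simp add: w_def sum_distrib_left[symmetric] t1')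
    ultimately show ?thesis by (simp add: N_def sum_lessThan_add)
  qed
  have cnj_comm: "x * cnj x = cnj x * x" for x by simp
  have norm: "(\<Sum>i<k * m. u s i * cnj (u s i)) = 1" if "s < N" for s
  proof (cases "s < k * m")
    case True
    have "(\<Sum>i<k * m. u s i * cnj (u s i)) =
      (\<Sum>i<k. \<Sum>j<m. (cnj (U $$ (i, s div m)) * U $$ (i, s div m)) * (cnj (W $$ (j, s mod m)) * W $$ (j, s mod m)))"
      unfolding sum_lessThan_mult using True by (intro sum.cong refl) (auto simp: u_def)
    also have "\<dots> = 1"
      unfolding sum_distrib_left[symmetric] sum_distrib_right[symmetric]
      using unitary_mat_columns[OF U split(1)[OF True] split(1)[OF True]]
        unitary_mat_columns[OF W split(2)[OF True] split(2)[OF True]] by simp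
    finally show ?thesis .
  next
    case False
    hence "s - k * m < k * m" using that by (auto simp: N_def)
    from unitary_mat_columns[OF X this this] show ?thesis
      using False by (simp add: u_def cnj_comm)
  qed
  let ?P = "\<lambda>s. outer (k * m) (u s)"
  have "pure_decomposition (k * m) ?\<omega> N w ?P"
    unfolding pure_decomposition_def
  proof (intro conjI allI impI)
    show "?\<omega> = mat (k * m) (k * m) (\<lambda>rc. \<Sum>i<N. complex_of_real (w i) * ?P i $$ rc)"
    proof (rule eq_matI)
      fix i j assume "i < dim_row (mat (k * m) (k * m) (\<lambda>rc. \<Sum>i<N. complex_of_real (w i) * ?P i $$ rc))"
        "j < dim_col (mat (k * m) (k * m) (\<lambda>rc. \<Sum>i<N. complex_of_real (w i) * ?P i $$ rc))"
      hence ij: "i < k * m" "j < k * m" by auto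
      have "(\<Sum>s<k * m. complex_of_real (w s) * ?P s $$ (i, j)) =
        (\<Sum>p<k. \<Sum>q<m. complex_of_real (1 - \<epsilon>) *
          ((U $$ (i div m, p) * complex_of_real (a p) * cnj (U $$ (j div m, p))) *
          (W $$ (i mod m, q) * complex_of_real (b q) * cnj (W $$ (j mod m, q)))))"
        unfolding sum_lessThan_mult using ij
        by (intro sum.cong refl) (auto simp: u_def w_def outer_def mult_add_less)
      also have "\<dots> = complex_of_real (1 - \<epsilon>) * (\<alpha> (i div m) (j div m) * \<beta> (i mod m) (j mod m))"
        unfolding \<alpha>_eq[OF split(1)[OF ij(1)] split(1)[OF ij(2)]] \<beta>_eq[OF split(2)[OF ij(1)] split(2)[OF ij(2)]]
        unfolding sum_product by (simp only: sum_distrib_left)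
      finally have 1: "(\<Sum>s<k * m. complex_of_real (w s) * ?P s $$ (i, j)) =
        complex_of_real (1 - \<epsilon>) * (\<alpha> (i div m) (j div m) * \<beta> (i mod m) (j mod m))" .
      have 2: "(\<Sum>s<k * m. complex_of_real (w (k * m + s)) * ?P (k * m + s) $$ (i, j)) = complex_of_real \<epsilon> * \<tau> i j"
        unfolding \<tau>_eq[OF ij] sum_distrib_left using ij
        by (intro sum.cong refl) (auto simp: u_def w_def outer_def)
      show "?\<omega> $$ (i, j) = mat (k * m) (k * m) (\<lambda>rc. \<Sum>i<N. complex_of_real (w i) * ?P i $$ rc) $$ (i, j)"
        using ij by (simp add: N_def sum_lessThan_add 1 2)
    qed auto
  qed (use w0 w1 norm in \<open>auto intro!: pure_state_outer\<close>)
  hence "eof k m ?\<omega> \<le> (\<Sum>s<N. w s * vn_entropy (ptrace_right k m (?P s)))"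
    unfolding eof_def
    by (intro cInf_lower bdd_below_eof CollectI exI[of _ N] exI[of _ w] exI[of _ ?P] conjI refl)
  also have "\<dots> = (\<Sum>s<k * m. w s * vn_entropy (ptrace_right k m (?P s))) +
      (\<Sum>s<k * m. w (k * m + s) * vn_entropy (ptrace_right k m (?P (k * m + s))))"
    by (simp add: N_def sum_lessThan_add)
  \<comment> \<open>Tracing out the unit vector taken from \<open>W\<close> leaves the projection
    onto a column of \<open>U\<close>, a pure state of the first factor.\<close>
  also have "(\<Sum>s<k * m. w s * vn_entropy (ptrace_right k m (?P s))) = 0"
  proof (rule sum.neutral, rule ballI)
    fix s assume "s \<in> {..<k * m}"
    hence s: "s < k * m" by simp
    have "ptrace_right k m (?P s) = mat k k (\<lambda>(i, j). \<Sum>r<m. u s (i * m + r) * cnj (u s (j * m + r)))"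
      by (rule ptrace_right_eq) (auto simp: outer_def)
    also have "\<dots> = outer k (\<lambda>i. U $$ (i, s div m))"
    proof (rule eq_matI)
      fix i j assume "i < dim_row (outer k (\<lambda>i. U $$ (i, s div m)))" "j < dim_col (outer k (\<lambda>i. U $$ (i, s div m)))"
      hence ij: "i < k" "j < k" by (auto simp: outer_def)
      have "(\<Sum>r<m. u s (i * m + r) * cnj (u s (j * m + r))) =
          (\<Sum>r<m. U $$ (i, s div m) * cnj (U $$ (j, s div m)) * (cnj (W $$ (r, s mod m)) * W $$ (r, s mod m)))"
        using s by (intro sum.cong refl) (auto simp: u_def)
      also have "\<dots> = U $$ (i, s div m) * cnj (U $$ (j, s div m))"
        using unitary_mat_columns[OF W split(2)[OF s] split(2)[OF s]]
        by (simp add: sum_distrib_left[symmetric])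
      finally show "mat k k (\<lambda>(i, j). \<Sum>r<m. u s (i * m + r) * cnj (u s (j * m + r))) $$ (i, j) =
          outer k (\<lambda>i. U $$ (i, s div m)) $$ (i, j)" using ij by (simp add: outer_def)
    qed (auto simp: outer_def)
    finally have "ptrace_right k m (?P s) = outer k (\<lambda>i. U $$ (i, s div m))" .
    moreover have "vn_entropy (outer k (\<lambda>i. U $$ (i, s div m))) = 0"
      using unitary_mat_columns[OF U split(1)[OF s] split(1)[OF s]]
      by (intro vn_entropy_outer) (simp add: cnj_comm)
    ultimately show "w s * vn_entropy (ptrace_right k m (?P s)) = 0" by simp
  qed
  also have "0 + (\<Sum>s<k * m. w (k * m + s) * vn_entropy (ptrace_right k m (?P (k * m + s)))) \<le>
      (\<Sum>s<k * m. \<epsilon> * t s * real k)"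
    unfolding add_0
  proof (rule sum_mono)
    fix s assume "s \<in> {..<k * m}"
    hence s: "s < k * m" by simp
    have "ptrace_right k m (?P (k * m + s)) =
        mat k k (\<lambda>(i, j). \<Sum>r<m. u (k * m + s) (i * m + r) * cnj (u (k * m + s) (j * m + r)))"
      by (rule ptrace_right_eq) (auto simp: outer_def)
    hence "vn_entropy (ptrace_right k m (?P (k * m + s))) \<le> real k"
      using vn_entropy_le_dim[OF psd_ptrace_right[OF psd_outer[of "{..<k * m}" "u (k * m + s)"]]] by simp
    thus "w (k * m + s) * vn_entropy (ptrace_right k m (?P (k * m + s))) \<le> \<epsilon> * t s * real k"
      using \<epsilon> t[OF s] by (auto simp: w_def intro!: mult_left_mono)
  qed
  also have "\<dots> = \<epsilon> * real k"
    by (simp add: sum_distrib_left[symmetric] sum_distrib_right[symmetric] t1')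
  finally show ?thesis by simp
qed

section \<open>Matrix products of a finitely correlated state\<close>

text \<open>The \<open>(r, s)\<close> entry of the product of the blocks \<open>V\<^sub>x\<close> of \<open>V\<close>, where \<open>x\<close> runs through the \<open>k\<close> digits
  of \<open>w\<close> in base \<open>d\<close>, the most significant one first.\<close>

primrec word :: "nat \<Rightarrow> nat \<Rightarrow> complex mat \<Rightarrow> nat \<Rightarrow> nat \<Rightarrow> nat \<Rightarrow> nat \<Rightarrow> complex" where
  "word d b V 0 w r s = (if r = s then 1 else 0)"
| "word d b V (Suc k) w r s = (\<Sum>t<b. word d b V k (w div d) r t * V $$ (t, w mod d * b + s))"

text \<open>Concatenating words multiplies the block products. The recursion of \<open>word\<close>
  peels off the last digit, so the induction runs over the length of the right word.\<close>

lemma word_append: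
  assumes "u < d ^ l" "r < b" "s < b"
  shows "word d b V (k + l) (w * d ^ l + u) r s = (\<Sum>t<b. word d b V k w r t * word d b V l u t s)"
  using assms(1,3)
proof (induction l arbitrary: u s)
  case 0
  hence "(\<Sum>t<b. word d b V k w r t * word d b V 0 u t s) = (\<Sum>t<b. if t = s then word d b V k w r t else 0)"
    by (intro sum.cong) auto
  thus ?case using 0 by simp
next
  case (Suc l)
  have d: "d > 0" using Suc.prems by (cases d) auto
  have u: "u div d < d ^ l" using Suc.prems by (simp add: less_mult_imp_div_less mult.commute)
  have e: "w * d ^ Suc l + u = u + d * (w * d ^ l)" by (simp add: algebra_simps)
  have dm: "(w * d ^ Suc l + u) div d = w * d ^ l + u div d" "(w * d ^ Suc l + u) mod d = u mod d"
    unfolding e using d by simp_all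
  have "word d b V (k + Suc l) (w * d ^ Suc l + u) r s =
      (\<Sum>t<b. \<Sum>c<b. word d b V k w r c * word d b V l (u div d) c t * V $$ (t, u mod d * b + s))"
    by (simp only: add_Suc_right word.simps dm)
      (intro sum.cong refl, simp add: Suc.IH[OF u] sum_distrib_right)
  also have "\<dots> = (\<Sum>c<b. \<Sum>t<b. word d b V k w r c * word d b V l (u div d) c t * V $$ (t, u mod d * b + s))"
    by (rule sum.swap)
  also have "\<dots> = (\<Sum>c<b. word d b V k w r c * word d b V (Suc l) u c s)"
    by (simp add: sum_distrib_left mult.assoc)
  finally show ?case .
qed

lemma word_1:
  assumes "x < d" "r < b"
  shows "word d b V 1 x r s = V $$ (r, x * b + s)"
proof -
  have "word d b V 1 x r s = (\<Sum>t<b. if t = r then V $$ (t, x * b + s) else 0)"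
    unfolding One_nat_def word.simps using assms by (intro sum.cong) auto
  thus ?thesis using assms by simp
qed

text \<open>A column of \<open>V\<close> carries one site digit and a memory index, so division by
  \<open>d * b\<close> strips the last digit of \<open>w\<close>, and block diagonality compares the
  remaining digits.\<close>

lemma kron_one_index:
  fixes V :: "complex mat"
  assumes V: "V \<in> carrier_mat b (d * b)" and "v < n" "t < b" "w < n * d" "s < b"
  shows "kron (1\<^sub>m n) V $$ (v * b + t, w * b + s) =
    (if v = w div d then V $$ (t, w mod d * b + s) else 0)"
proof -
  have b: "b > 0" and d: "d > 0" using assms by (cases b, auto, cases d, auto)
  have "(w * b + s) div (d * b) = w div d"
    using assms div_mult2_eq[of "w * b + s" b d] by (simp add: mult.commute)
  moreover have "(w * b + s) mod (d * b) = w mod d * b + s"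
    using assms mod_mult2_eq[of "w * b + s" b d] by (simp add: mult.commute)
  moreover have "v * b + t < n * b" using assms by (intro mult_add_less)
  moreover have "w * b + s < n * (d * b)"
    using mult_add_less[OF assms(4,5)] by (simp add: mult.assoc)
  moreover have "w div d < n" using assms by (simp add: less_mult_imp_div_less)
  ultimately show ?thesis using assms by (auto simp: kron_def)
qed

lemma fcs_V_Suc: "1 \<le> n \<Longrightarrow> fcs_V d b V (Suc n) = fcs_V d b V n * kron (1\<^sub>m (d ^ n)) V"
  by (simp add: fcs_V_def)

lemma fcs_V_carrier:
  assumes "V \<in> carrier_mat b (d * b)" "1 \<le> n"
  shows "fcs_V d b V n \<in> carrier_mat (d * b) (d ^ n * b)"
  using assms(2)
proof (induction n rule: nat_induct_at_least)
  case (Suc n)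
  have "kron (1\<^sub>m (d ^ n)) V \<in> carrier_mat (d ^ n * b) (d ^ Suc n * b)"
    using assms by (auto simp: kron_def)
  thus ?case using Suc by (simp add: fcs_V_Suc)
qed (simp add: fcs_V_def)

text \<open>\<open>fcs_V\<close> holds \<open>n - 1\<close> copies of \<open>V\<close>; the
  \<open>V\<close> in front, which comes from the density matrix of one site and the memory,
  supplies the first digit.\<close>

lemma fcs_V_word:
  assumes V: "V \<in> carrier_mat b (d * b)" and "1 \<le> n" "w < d ^ n" "r < b" "s < b"
  shows "(V * fcs_V d b V n) $$ (r, w * b + s) = word d b V n w r s"
  using assms(2,3,5)
proof (induction n arbitrary: w s rule: nat_induct_at_least)
  case base
  thus ?case using V word_1[of w d r b V s] assms(4) by (simp add: fcs_V_def)
next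
  case (Suc n)
  have F: "fcs_V d b V n \<in> carrier_mat (d * b) (d ^ n * b)"
    using fcs_V_carrier[OF V Suc.hyps] .
  have K: "kron (1\<^sub>m (d ^ n)) V \<in> carrier_mat (d ^ n * b) (d ^ Suc n * b)"
    using V by (auto simp: kron_def)
  have w: "w < d ^ n * d" using Suc.prems by (simp add: mult.commute)
  have wd: "w div d < d ^ n" using w by (simp add: less_mult_imp_div_less)
  have "(V * fcs_V d b V (Suc n)) $$ (r, w * b + s) =
      (V * fcs_V d b V n * kron (1\<^sub>m (d ^ n)) V) $$ (r, w * b + s)"
    using assoc_mult_mat[OF V F K] by (simp add: fcs_V_Suc[OF Suc.hyps])
  also have "\<dots> = (\<Sum>c<d ^ n * b. (V * fcs_V d b V n) $$ (r, c) * kron (1\<^sub>m (d ^ n)) V $$ (c, w * b + s))"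
    by (rule mat_mult_index[OF mult_carrier_mat[OF V F] K])
      (use assms mult_add_less[OF Suc.prems] in auto)
  also have "\<dots> = (\<Sum>v<d ^ n. \<Sum>t<b. (V * fcs_V d b V n) $$ (r, v * b + t) *
      (if v = w div d then V $$ (t, w mod d * b + s) else 0))"
    unfolding sum_lessThan_mult
    using w Suc.prems by (intro sum.cong refl arg_cong2[of _ _ _ _ "(*)"] kron_one_index[OF V]) auto
  also have "\<dots> = (\<Sum>v<d ^ n. if v = w div d then
      (\<Sum>t<b. (V * fcs_V d b V n) $$ (r, v * b + t) * V $$ (t, w mod d * b + s)) else 0)"
    by (intro sum.cong refl) auto
  also have "\<dots> = (\<Sum>t<b. (V * fcs_V d b V n) $$ (r, w div d * b + t) * V $$ (t, w mod d * b + s))"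
    using wd by simp
  also have "\<dots> = word d b V (Suc n) w r s"
    unfolding word.simps using Suc.IH[OF wd] by (intro sum.cong refl) auto
  finally show ?case .
qed

section \<open>Density matrices of the chain in terms of words\<close>

context pure_fcs
begin

abbreviation W where "W \<equiv> word d b V"

text \<open>The entries of \<open>fcs_rho\<close>, with \<open>s\<close> the traced memory index, in
  a form that can be cut between any two sites because words can.\<close>

definition chain_state :: "nat \<Rightarrow> nat \<Rightarrow> nat \<Rightarrow> complex" where
  "chain_state n i j = (\<Sum>s<b. \<Sum>r<b. \<Sum>r'<b. cnj (W n i r s) * \<rho> $$ (r, r') * W n j r' s)"

lemma rho_carrier: "\<rho> \<in> carrier_mat b b" and rho_trace: "(\<Sum>r<b. \<rho> $$ (r, r)) = 1"
  using rho_density by (auto simp: density_mat_def mat_trace_def)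

lemma rho_psd: "psd {..<b} (\<lambda>r r'. \<rho> $$ (r, r'))"
  using density_mat_psd[OF rho_density] .

lemma V_orthonormal_rows:
  assumes "t < b" "t' < b"
  shows "(\<Sum>x<d. \<Sum>s<b. V $$ (t, x * b + s) * cnj (V $$ (t', x * b + s))) = (if t = t' then 1 else 0)"
proof -
  have "(V * mat_adjoint V) $$ (t, t') = (\<Sum>i<d * b. V $$ (t, i) * cnj (V $$ (t', i)))"
    unfolding mat_mult_index[OF V_carrier mat_adjoint_carrier[OF V_carrier] assms]
    using assms V_carrier by (intro sum.cong) auto
  thus ?thesis using assms by (simp add: V_coisometry sum_lessThan_mult)
qed

text \<open>The identity \<open>V V\<^sup>\<dagger> = 1\<close> iterated along the chain. It
  normalizes the states and later bounds the gap channel uniformly in its length.\<close>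

lemma word_orthonormal_rows:
  assumes "r < b" "r' < b"
  shows "(\<Sum>i<d ^ n. \<Sum>s<b. cnj (W n i r s) * W n i r' s) = (if r = r' then 1 else 0)"
proof (induction n)
  case 0
  have "(\<Sum>s<b. cnj (W 0 0 r s) * W 0 0 r' s) = (\<Sum>s<b. if s = r then if r = r' then 1 else 0 else 0)"
    by (intro sum.cong) auto
  thus ?case using assms by simp
next
  case (Suc n)
  have "(\<Sum>i<d ^ Suc n. \<Sum>s<b. cnj (W (Suc n) i r s) * W (Suc n) i r' s) =
      (\<Sum>i<d ^ n. \<Sum>x<d. \<Sum>s<b. \<Sum>t<b. \<Sum>t'<b. cnj (W n i r t) * W n i r' t' *
        (V $$ (t', x * b + s) * cnj (V $$ (t, x * b + s))))"
    unfolding power_Suc2 sum_lessThan_mult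
    by (intro sum.cong refl, simp add: sum_product, intro sum.cong refl, simp add: mult_ac)
  \<comment> \<open>The sums over the last site and the new memory index move inside, where
    orthonormality of the rows of \<open>V\<close> applies.\<close>
  also have "\<dots> = (\<Sum>i<d ^ n. \<Sum>t<b. \<Sum>t'<b. \<Sum>x<d. \<Sum>s<b. cnj (W n i r t) * W n i r' t' *
        (V $$ (t', x * b + s) * cnj (V $$ (t, x * b + s))))" (is "(\<Sum>i<d ^ n. ?L i) = (\<Sum>i<d ^ n. ?R i)")
  proof (rule sum.cong[OF refl])
    fix i
    let ?h = "\<lambda>x s t t'. cnj (W n i r t) * W n i r' t' * (V $$ (t', x * b + s) * cnj (V $$ (t, x * b + s)))"
    have "?L i = (\<Sum>x<d. \<Sum>t<b. \<Sum>s<b. \<Sum>t'<b. ?h x s t t')" by (intro sum.cong refl sum.swap)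
    also have "\<dots> = (\<Sum>t<b. \<Sum>x<d. \<Sum>s<b. \<Sum>t'<b. ?h x s t t')" by (rule sum.swap)
    also have "\<dots> = (\<Sum>t<b. \<Sum>x<d. \<Sum>t'<b. \<Sum>s<b. ?h x s t t')" by (intro sum.cong refl sum.swap)
    also have "\<dots> = ?R i" by (intro sum.cong refl sum.swap)
    finally show "?L i = ?R i" .
  qed
  also have "\<dots> = (\<Sum>i<d ^ n. \<Sum>t<b. \<Sum>t'<b. if t' = t then cnj (W n i r t) * W n i r' t' else 0)"
    by (intro sum.cong refl) (simp add: sum_distrib_left[symmetric] V_orthonormal_rows)
  also have "\<dots> = (\<Sum>i<d ^ n. \<Sum>t<b. cnj (W n i r t) * W n i r' t)"
    by (intro sum.cong refl) simp
  finally show ?case using Suc.IH by simp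
qed

text \<open>Regrouping exhibits a congruence of \<open>\<rho>\<close> by \<open>V\<close> times
  \<open>fcs_V\<close>, whose entries are words.\<close>

lemma fcs_rho_eq:
  assumes "1 \<le> n" "i < d ^ n" "j < d ^ n"
  shows "fcs_rho d b V \<rho> n $$ (i, j) = chain_state n i j"
proof -
  let ?F = "fcs_V d b V n"
  note F = fcs_V_carrier[OF V_carrier assms(1)]
  note F' = mat_adjoint_carrier[OF F] and V' = mat_adjoint_carrier[OF V_carrier]
  have VF: "V * ?F \<in> carrier_mat b (d ^ n * b)" using V_carrier F by simp
  have "mat_adjoint ?F * (mat_adjoint V * \<rho> * V) * ?F = mat_adjoint ?F * (mat_adjoint V * \<rho> * V * ?F)"
    using F F' V' V_carrier rho_carrier by (intro assoc_mult_mat) auto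
  also have "mat_adjoint V * \<rho> * V * ?F = mat_adjoint V * (\<rho> * (V * ?F))"
  proof -
    have "mat_adjoint V * \<rho> * V * ?F = mat_adjoint V * \<rho> * (V * ?F)"
      by (rule assoc_mult_mat[OF mult_carrier_mat[OF V' rho_carrier] V_carrier F])
    thus ?thesis using assoc_mult_mat[OF V' rho_carrier VF] by simp
  qed
  also have "mat_adjoint ?F * (mat_adjoint V * (\<rho> * (V * ?F))) = mat_adjoint ?F * mat_adjoint V * (\<rho> * (V * ?F))"
    by (rule assoc_mult_mat[OF F' V' mult_carrier_mat[OF rho_carrier VF], symmetric])
  also have "\<dots> = mat_adjoint (V * ?F) * \<rho> * (V * ?F)"
    unfolding mat_adjoint_mult[OF V_carrier F, symmetric]
    by (rule assoc_mult_mat[OF mat_adjoint_carrier[OF VF] rho_carrier VF, symmetric])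
  finally have "fcs_rho d b V \<rho> n $$ (i, j) =
      (\<Sum>s<b. (mat_adjoint (V * ?F) * \<rho> * (V * ?F)) $$ (i * b + s, j * b + s))"
    using assms by (simp add: fcs_rho_def ptrace_right_def)
  also have "\<dots> = chain_state n i j"
    unfolding chain_state_def
  proof (intro sum.cong refl)
    fix s assume "s \<in> {..<b}"
    hence s: "s < b" by simp
    show "(mat_adjoint (V * ?F) * \<rho> * (V * ?F)) $$ (i * b + s, j * b + s) =
        (\<Sum>r<b. \<Sum>r'<b. cnj (W n i r s) * \<rho> $$ (r, r') * W n j r' s)"
      unfolding mat_congruence_index[OF rho_carrier VF mult_add_less[OF assms(2) s] mult_add_less[OF assms(3) s]]
      using fcs_V_word[OF V_carrier assms(1,2) _ s] fcs_V_word[OF V_carrier assms(1,3) _ s]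
      by (intro sum.cong refl) auto
  qed
  finally show ?thesis .
qed

lemma chain_state_psd: "psd I (chain_state n)"
proof (rule psd_eq)
  show "psd I (\<lambda>i j. \<Sum>s\<in>{..<b}. \<Sum>r<b. \<Sum>r'<b. cnj (W n i r s) * \<rho> $$ (r, r') * W n j r' s)"
    by (intro psd_sum psd_congruence[OF rho_psd, of _ "\<lambda>r i. W n i r _"])
qed (simp add: chain_state_def)

lemma chain_state_trace: "(\<Sum>i<d ^ n. chain_state n i i) = 1"
proof -
  let ?h = "\<lambda>i s r r'. \<rho> $$ (r, r') * (cnj (W n i r s) * W n i r' s)"
  have "(\<Sum>i<d ^ n. chain_state n i i) = (\<Sum>i<d ^ n. \<Sum>s<b. \<Sum>r<b. \<Sum>r'<b. ?h i s r r')"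
    unfolding chain_state_def by (intro sum.cong refl) (simp add: mult_ac)
  also have "\<dots> = (\<Sum>i<d ^ n. \<Sum>r<b. \<Sum>s<b. \<Sum>r'<b. ?h i s r r')" by (intro sum.cong refl sum.swap)
  also have "\<dots> = (\<Sum>r<b. \<Sum>i<d ^ n. \<Sum>s<b. \<Sum>r'<b. ?h i s r r')" by (rule sum.swap)
  also have "\<dots> = (\<Sum>r<b. \<Sum>i<d ^ n. \<Sum>r'<b. \<Sum>s<b. ?h i s r r')" by (intro sum.cong refl sum.swap)
  also have "\<dots> = (\<Sum>r<b. \<Sum>r'<b. \<Sum>i<d ^ n. \<Sum>s<b. ?h i s r r')" by (intro sum.cong refl sum.swap)
  also have "\<dots> = (\<Sum>r<b. \<Sum>r'<b. if r' = r then \<rho> $$ (r, r') else 0)"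
    by (intro sum.cong refl) (auto simp: sum_distrib_left[symmetric] word_orthonormal_rows)
  also have "\<dots> = 1" by (simp add: rho_trace)
  finally show ?thesis .
qed

section \<open>The gap\<close>

text \<open>The Choi kernel of \<open>X \<mapsto> \<Sum>\<^sub>w V\<^sub>w\<^sup>\<dagger> X V\<^sub>w\<close>, with \<open>w\<close> over the words of length \<open>k\<close>: the index \<open>(a, c)\<close> consists
  of an input \<open>a\<close> and an output \<open>c\<close>.\<close>

definition gap_channel :: "nat \<Rightarrow> nat \<times> nat \<Rightarrow> nat \<times> nat \<Rightarrow> complex" where
  "gap_channel k p q = (\<Sum>w<d ^ k. cnj (W k w (fst p) (snd p)) * W k w (fst q) (snd q))"

text \<open>The Choi kernel of \<open>X \<mapsto> Tr(X) \<rho>\<close>: equality of the inputs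
  produces the trace.\<close>

definition limit_channel :: "nat \<times> nat \<Rightarrow> nat \<times> nat \<Rightarrow> complex" where
  "limit_channel p q = (if fst p = fst q then \<rho> $$ (snd p, snd q) else 0)"

text \<open>\<open>glue m K\<close> is the state of site 1 and of the last \<open>m\<close> sites when the map with Choi kernel \<open>K\<close> acts on
  the memory in between.\<close>

definition ends :: "nat \<Rightarrow> nat \<Rightarrow> nat \<times> nat \<times> nat \<Rightarrow> nat \<Rightarrow> complex" where
  "ends m s p i = W 1 (i div d ^ m) (fst p) (fst (snd p)) * W m (i mod d ^ m) (snd (snd p)) s"

definition glue :: "nat \<Rightarrow> (nat \<times> nat \<Rightarrow> nat \<times> nat \<Rightarrow> complex) \<Rightarrow> nat \<Rightarrow> nat \<Rightarrow> complex" where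
  "glue m K i j = (\<Sum>s<b. \<Sum>p\<in>{..<b} \<times> {..<b} \<times> {..<b}. \<Sum>q\<in>{..<b} \<times> {..<b} \<times> {..<b}.
    cnj (ends m s p i) * (\<rho> $$ (fst p, fst q) * K (snd p) (snd q)) * ends m s q j)"

text \<open>Positivity of the Choi kernel means complete positivity of the map, which is what
  survives the correlation of the memory with site 1: tensor with \<open>\<rho>\<close>, then apply
  the congruence by \<open>ends\<close>.\<close>

lemma glue_psd: "psd ({..<b} \<times> {..<b}) K \<Longrightarrow> psd I (glue m K)"
proof (rule psd_eq)
  assume "psd ({..<b} \<times> {..<b}) K"
  from psd_tensor[OF rho_psd this]
  show "psd I (\<lambda>i j. \<Sum>s\<in>{..<b}. \<Sum>p\<in>{..<b} \<times> {..<b} \<times> {..<b}. \<Sum>q\<in>{..<b} \<times> {..<b} \<times> {..<b}.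
    cnj (ends m s p i) * (\<rho> $$ (fst p, fst q) * K (snd p) (snd q)) * ends m s q j)"
    by (intro psd_sum psd_congruence[of _ "\<lambda>p q. \<rho> $$ (fst p, fst q) * K (snd p) (snd q)"]) auto
qed (simp add: glue_def)

lemma glue_diff:
  "glue m (\<lambda>p q. f p q - c * g p q) i j = glue m f i j - c * glue m g i j"
  unfolding glue_def sum_distrib_left sum_subtractf[symmetric]
  by (intro sum.cong refl) (simp add: algebra_simps)

lemma glue_eq:
  "glue m K i j = (\<Sum>s<b. \<Sum>r<b. \<Sum>r'<b. \<rho> $$ (r, r') * (\<Sum>a<b. \<Sum>c<b. \<Sum>a'<b. \<Sum>c'<b.
    cnj (W 1 (i div d ^ m) r a * W m (i mod d ^ m) c s) * K (a, c) (a', c') *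
    (W 1 (j div d ^ m) r' a' * W m (j mod d ^ m) c' s)))"
  (is "_ = (\<Sum>s<b. ?R s)")
  unfolding glue_def
proof (intro sum.cong refl)
  fix s
  let ?t = "\<lambda>r r' a c a' c'. cnj (W 1 (i div d ^ m) r a * W m (i mod d ^ m) c s) *
    (\<rho> $$ (r, r') * K (a, c) (a', c')) * (W 1 (j div d ^ m) r' a' * W m (j mod d ^ m) c' s)"
  have "(\<Sum>p\<in>{..<b} \<times> {..<b} \<times> {..<b}. \<Sum>q\<in>{..<b} \<times> {..<b} \<times> {..<b}.
      cnj (ends m s p i) * (\<rho> $$ (fst p, fst q) * K (snd p) (snd q)) * ends m s q j) =
    (\<Sum>r<b. \<Sum>a<b. \<Sum>c<b. \<Sum>r'<b. \<Sum>a'<b. \<Sum>c'<b. ?t r r' a c a' c')"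
    by (simp add: sum.cartesian_product' ends_def)
  also have "\<dots> = (\<Sum>r<b. \<Sum>a<b. \<Sum>r'<b. \<Sum>c<b. \<Sum>a'<b. \<Sum>c'<b. ?t r r' a c a' c')"
    by (intro sum.cong refl sum.swap)
  also have "\<dots> = (\<Sum>r<b. \<Sum>r'<b. \<Sum>a<b. \<Sum>c<b. \<Sum>a'<b. \<Sum>c'<b. ?t r r' a c a' c')"
    by (intro sum.cong refl sum.swap)
  also have "\<dots> = ?R s"
    unfolding sum_distrib_left by (intro sum.cong refl) (simp add: mult_ac)
  finally show "(\<Sum>p\<in>{..<b} \<times> {..<b} \<times> {..<b}. \<Sum>q\<in>{..<b} \<times> {..<b} \<times> {..<b}.
      cnj (ends m s p i) * (\<rho> $$ (fst p, fst q) * K (snd p) (snd q)) * ends m s q j) = ?R s" .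
qed

text \<open>Equal inputs \<open>a\<close> close the left end into the state of site 1, while the
  fresh \<open>\<rho>\<close> at the output starts an independent chain of length
  \<open>m\<close>.\<close>

lemma glue_limit:
  "glue m limit_channel i j = chain_state 1 (i div d ^ m) (j div d ^ m) * chain_state m (i mod d ^ m) (j mod d ^ m)"
proof -
  define x y u v where "x = i div d ^ m" and "y = j div d ^ m" and "u = i mod d ^ m" and "v = j mod d ^ m"
  let ?A = "\<lambda>r r' a. cnj (W 1 x r a) * \<rho> $$ (r, r') * W 1 y r' a"
  let ?B = "\<lambda>s c c'. cnj (W m u c s) * \<rho> $$ (c, c') * W m v c' s"
  have inner: "(\<Sum>a<b. \<Sum>c<b. \<Sum>a'<b. \<Sum>c'<b. cnj (W 1 x r a * W m u c s) * limit_channel (a, c) (a', c') *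
      (W 1 y r' a' * W m v c' s)) =
    (\<Sum>a<b. cnj (W 1 x r a) * W 1 y r' a) * (\<Sum>c<b. \<Sum>c'<b. ?B s c c')" for r r' s
  proof -
    have "(\<Sum>a<b. \<Sum>c<b. \<Sum>a'<b. \<Sum>c'<b. cnj (W 1 x r a * W m u c s) * limit_channel (a, c) (a', c') *
      (W 1 y r' a' * W m v c' s)) =
      (\<Sum>a<b. \<Sum>c<b. \<Sum>a'<b. if a' = a then (\<Sum>c'<b. (cnj (W 1 x r a) * W 1 y r' a') * ?B s c c') else 0)"
    proof (intro sum.cong refl)
      fix a c a'
      show "(\<Sum>c'<b. cnj (W 1 x r a * W m u c s) * limit_channel (a, c) (a', c') * (W 1 y r' a' * W m v c' s)) =
          (if a' = a then (\<Sum>c'<b. (cnj (W 1 x r a) * W 1 y r' a') * ?B s c c') else 0)"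
      proof (cases "a' = a")
        case True
        show ?thesis
          unfolding True
          by (simp only: limit_channel_def fst_conv snd_conv if_True refl complex_cnj_mult mult_ac)
      qed (simp add: limit_channel_def)
    qed
    also have "\<dots> = (\<Sum>a<b. \<Sum>c<b. \<Sum>c'<b. (cnj (W 1 x r a) * W 1 y r' a) * ?B s c c')"
    proof (rule sum.cong[OF refl], rule sum.cong[OF refl])
      fix a c assume "a \<in> {..<b}"
      thus "(\<Sum>a'<b. if a' = a then (\<Sum>c'<b. (cnj (W 1 x r a) * W 1 y r' a') * ?B s c c') else 0) =
          (\<Sum>c'<b. (cnj (W 1 x r a) * W 1 y r' a) * ?B s c c')"
        by (simp only: sum.delta finite_lessThan if_True)
    qed
    finally show ?thesis by (simp only: sum_distrib_left[symmetric] sum_distrib_right[symmetric])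
  qed
  have "chain_state 1 x y = (\<Sum>r<b. \<Sum>a<b. \<Sum>r'<b. ?A r r' a)"
    unfolding chain_state_def by (rule sum.swap)
  also have "\<dots> = (\<Sum>r<b. \<Sum>r'<b. \<Sum>a<b. ?A r r' a)"
    by (intro sum.cong refl sum.swap)
  also have "\<dots> = (\<Sum>r<b. \<Sum>r'<b. \<rho> $$ (r, r') * (\<Sum>a<b. cnj (W 1 x r a) * W 1 y r' a))"
    unfolding sum_distrib_left by (intro sum.cong refl) (simp add: mult_ac)
  finally have 1: "chain_state 1 x y = \<dots>" .
  have "glue m limit_channel i j = (\<Sum>s<b. \<Sum>r<b. \<Sum>r'<b. \<rho> $$ (r, r') *
      ((\<Sum>a<b. cnj (W 1 x r a) * W 1 y r' a) * (\<Sum>c<b. \<Sum>c'<b. ?B s c c')))"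
    unfolding glue_eq x_def[symmetric] y_def[symmetric] u_def[symmetric] v_def[symmetric] inner ..
  also have "\<dots> = (\<Sum>s<b. chain_state 1 x y * (\<Sum>c<b. \<Sum>c'<b. ?B s c c'))"
    unfolding 1 by (simp only: sum_distrib_right mult.assoc)
  also have "\<dots> = chain_state 1 x y * chain_state m u v"
    unfolding chain_state_def[of m] sum_distrib_left ..
  finally show ?thesis unfolding x_def y_def u_def v_def .
qed

text \<open>The word is cut on both sides of the gap. Both indices share the gap word
  \<open>w\<close>, since those sites are about to be traced out.\<close>

lemma chain_state_split:
  assumes "x < d" "y < d" "w < d ^ k" "u < d ^ m" "v < d ^ m"
  shows "chain_state (1 + k + m) ((x * d ^ k + w) * d ^ m + u) ((y * d ^ k + w) * d ^ m + v) =
    (\<Sum>s<b. \<Sum>r<b. \<Sum>r'<b. \<rho> $$ (r, r') * (\<Sum>a<b. \<Sum>c<b. \<Sum>a'<b. \<Sum>c'<b.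
      cnj (W 1 x r a * W m u c s) * (cnj (W k w a c) * W k w a' c') * (W 1 y r' a' * W m v c' s)))"
proof -
  have split: "W (1 + k + m) ((z * d ^ k + w) * d ^ m + t) r s =
      (\<Sum>a<b. \<Sum>c<b. W 1 z r a * W k w a c * W m t c s)"
    if "z < d" "t < d ^ m" "r < b" "s < b" for z t r s
  proof -
    have "W (1 + k + m) ((z * d ^ k + w) * d ^ m + t) r s =
        (\<Sum>c<b. W (1 + k) (z * d ^ k + w) r c * W m t c s)"
      by (rule word_append[OF that(2,3,4)])
    also have "\<dots> = (\<Sum>c<b. \<Sum>a<b. W 1 z r a * W k w a c * W m t c s)"
      unfolding sum_distrib_right[symmetric]
      by (intro sum.cong refl arg_cong2[of _ _ _ _ "(*)"] word_append assms that) auto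
    also have "\<dots> = (\<Sum>a<b. \<Sum>c<b. W 1 z r a * W k w a c * W m t c s)" by (rule sum.swap)
    finally show ?thesis .
  qed
  show ?thesis
    unfolding chain_state_def
  proof (intro sum.cong refl)
    fix s r r' assume "s \<in> {..<b}" "r \<in> {..<b}" "r' \<in> {..<b}"
    hence s: "s < b" and r: "r < b" and r': "r' < b" by auto
    show "cnj (W (1 + k + m) ((x * d ^ k + w) * d ^ m + u) r s) * \<rho> $$ (r, r') *
        W (1 + k + m) ((y * d ^ k + w) * d ^ m + v) r' s =
      \<rho> $$ (r, r') * (\<Sum>a<b. \<Sum>c<b. \<Sum>a'<b. \<Sum>c'<b.
      cnj (W 1 x r a * W m u c s) * (cnj (W k w a c) * W k w a' c') * (W 1 y r' a' * W m v c' s))"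
    proof -
      let ?F = "\<lambda>a c. cnj (W 1 x r a * W k w a c * W m u c s)"
      let ?G = "\<lambda>a c. W 1 y r' a * W k w a c * W m v c s"
      have "cnj (W (1 + k + m) ((x * d ^ k + w) * d ^ m + u) r s) * \<rho> $$ (r, r') *
          W (1 + k + m) ((y * d ^ k + w) * d ^ m + v) r' s =
        \<rho> $$ (r, r') * ((\<Sum>a<b. \<Sum>c<b. ?F a c) * (\<Sum>a<b. \<Sum>c<b. ?G a c))"
        unfolding split[OF assms(1,4) r s] split[OF assms(2,5) r' s] cnj_sum by (simp only: mult_ac)
      also have "(\<Sum>a<b. \<Sum>c<b. ?F a c) * (\<Sum>a<b. \<Sum>c<b. ?G a c) =
          (\<Sum>a<b. \<Sum>c<b. \<Sum>a'<b. \<Sum>c'<b. ?F a c * ?G a' c')"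
        by (simp only: sum_distrib_left[symmetric] sum_distrib_right[symmetric])
      also have "\<dots> = (\<Sum>a<b. \<Sum>c<b. \<Sum>a'<b. \<Sum>c'<b.
          cnj (W 1 x r a * W m u c s) * (cnj (W k w a c) * W k w a' c') * (W 1 y r' a' * W m v c' s))"
        by (intro sum.cong refl) (simp only: complex_cnj_mult mult_ac)
      finally show ?thesis .
    qed
  qed
qed

text \<open>Summing over the common gap word is the partial trace over the gap; on the memory the
  same sum is \<open>gap_channel\<close>.\<close>

lemma glue_gap:
  assumes i: "i < d * d ^ m" and j: "j < d * d ^ m"
  shows "glue m (gap_channel k) i j = (\<Sum>w<d ^ k. chain_state (1 + k + m)
    ((i div d ^ m * d ^ k + w) * d ^ m + i mod d ^ m) ((j div d ^ m * d ^ k + w) * d ^ m + j mod d ^ m))"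
proof -
  have d: "d ^ m > 0" using d_ge_1 by simp
  have ij: "i div d ^ m < d" "j div d ^ m < d" "i mod d ^ m < d ^ m" "j mod d ^ m < d ^ m"
    using i j d by (auto simp: less_mult_imp_div_less)
  let ?h = "\<lambda>w s r r'. \<rho> $$ (r, r') * (\<Sum>a<b. \<Sum>c<b. \<Sum>a'<b. \<Sum>c'<b.
      cnj (W 1 (i div d ^ m) r a * W m (i mod d ^ m) c s) * (cnj (W k w a c) * W k w a' c') *
      (W 1 (j div d ^ m) r' a' * W m (j mod d ^ m) c' s))"
  have "(\<Sum>w<d ^ k. chain_state (1 + k + m)
      ((i div d ^ m * d ^ k + w) * d ^ m + i mod d ^ m) ((j div d ^ m * d ^ k + w) * d ^ m + j mod d ^ m)) =
    (\<Sum>w<d ^ k. \<Sum>s<b. \<Sum>r<b. \<Sum>r'<b. ?h w s r r')"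
    by (intro sum.cong refl chain_state_split ij) auto
  also have "\<dots> = (\<Sum>s<b. \<Sum>w<d ^ k. \<Sum>r<b. \<Sum>r'<b. ?h w s r r')" by (rule sum.swap)
  also have "\<dots> = (\<Sum>s<b. \<Sum>r<b. \<Sum>w<d ^ k. \<Sum>r'<b. ?h w s r r')" by (intro sum.cong refl sum.swap)
  also have "\<dots> = (\<Sum>s<b. \<Sum>r<b. \<Sum>r'<b. \<Sum>w<d ^ k. ?h w s r r')" by (intro sum.cong refl sum.swap)
  also have "\<dots> = glue m (gap_channel k) i j"
    unfolding glue_eq
  proof (intro sum.cong refl)
    fix s r r'
    let ?g = "\<lambda>w a c a' c'. cnj (W 1 (i div d ^ m) r a * W m (i mod d ^ m) c s) * (cnj (W k w a c) * W k w a' c') *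
      (W 1 (j div d ^ m) r' a' * W m (j mod d ^ m) c' s)"
    have "(\<Sum>w<d ^ k. \<Sum>a<b. \<Sum>c<b. \<Sum>a'<b. \<Sum>c'<b. ?g w a c a' c') =
        (\<Sum>a<b. \<Sum>w<d ^ k. \<Sum>c<b. \<Sum>a'<b. \<Sum>c'<b. ?g w a c a' c')" by (rule sum.swap)
    also have "\<dots> = (\<Sum>a<b. \<Sum>c<b. \<Sum>w<d ^ k. \<Sum>a'<b. \<Sum>c'<b. ?g w a c a' c')" by (intro sum.cong refl sum.swap)
    also have "\<dots> = (\<Sum>a<b. \<Sum>c<b. \<Sum>a'<b. \<Sum>w<d ^ k. \<Sum>c'<b. ?g w a c a' c')" by (intro sum.cong refl sum.swap)
    also have "\<dots> = (\<Sum>a<b. \<Sum>c<b. \<Sum>a'<b. \<Sum>c'<b. \<Sum>w<d ^ k. ?g w a c a' c')" by (intro sum.cong refl sum.swap)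
    finally show "(\<Sum>w<d ^ k. ?h w s r r') = \<rho> $$ (r, r') * (\<Sum>a<b. \<Sum>c<b. \<Sum>a'<b. \<Sum>c'<b.
        cnj (W 1 (i div d ^ m) r a * W m (i mod d ^ m) c s) * gap_channel k (a, c) (a', c') *
        (W 1 (j div d ^ m) r' a' * W m (j mod d ^ m) c' s))"
      by (simp only: sum_distrib_left[symmetric] sum_distrib_right[symmetric] gap_channel_def fst_conv snd_conv)
  qed
  finally show ?thesis ..
qed

lemma fcs_rho_gap_eq:
  assumes "2 \<le> p" "p \<le> n"
  defines "m \<equiv> n - p + 1"
  shows "fcs_rho_gap d b V \<rho> p n = mat (d * d ^ m) (d * d ^ m) (\<lambda>(i, j). glue m (gap_channel (p - 2)) i j)"
proof (rule eq_matI)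
  let ?k = "p - 2"
  fix i j assume "i < dim_row (mat (d * d ^ m) (d * d ^ m) (\<lambda>(i, j). glue m (gap_channel ?k) i j))"
    "j < dim_col (mat (d * d ^ m) (d * d ^ m) (\<lambda>(i, j). glue m (gap_channel ?k) i j))"
  hence ij: "i < d * d ^ m" "j < d * d ^ m" by auto
  have d: "d ^ m > 0" using d_ge_1 by simp
  \<comment> \<open>For \<open>p = 2\<close> the gap is empty and \<open>gap_channel 0\<close> is
    the Choi kernel of the identity.\<close>
  have n: "n = 1 + ?k + m" using assms by (simp add: m_def)
  have idx: "(z div d ^ m * d ^ ?k + w) * d ^ m + z mod d ^ m < d ^ n"
    if "z < d * d ^ m" "w < d ^ ?k" for z w
  proof -
    have "(z div d ^ m * d ^ ?k + w) * d ^ m + z mod d ^ m < (d * d ^ ?k) * d ^ m"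
      using that d by (intro mult_add_less) (auto simp: less_mult_imp_div_less)
    thus ?thesis unfolding n by (simp add: power_add mult.assoc)
  qed
  have "fcs_rho_gap d b V \<rho> p n $$ (i, j) = (\<Sum>w<d ^ ?k. fcs_rho d b V \<rho> n $$
      ((i div d ^ m * d ^ ?k + w) * d ^ m + i mod d ^ m, (j div d ^ m * d ^ ?k + w) * d ^ m + j mod d ^ m))"
    using ij by (simp add: fcs_rho_gap_def ptrace_mid_def m_def)
  also have "\<dots> = (\<Sum>w<d ^ ?k. chain_state n
      ((i div d ^ m * d ^ ?k + w) * d ^ m + i mod d ^ m) ((j div d ^ m * d ^ ?k + w) * d ^ m + j mod d ^ m))"
    using assms ij by (intro sum.cong refl fcs_rho_eq idx) auto
  also have "\<dots> = glue m (gap_channel ?k) i j"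
    unfolding glue_gap[OF ij] n[symmetric] ..
  finally show "fcs_rho_gap d b V \<rho> p n $$ (i, j) =
      mat (d * d ^ m) (d * d ^ m) (\<lambda>(i, j). glue m (gap_channel ?k) i j) $$ (i, j)"
    using ij by simp
qed (auto simp: fcs_rho_gap_def ptrace_mid_def m_def)

text \<open>Tracing the ends after the gap traces the whole chain. This later fixes the
  normalization of the remainder \<open>\<tau>\<close>.\<close>

lemma glue_gap_trace: "(\<Sum>i<d * d ^ m. glue m (gap_channel k) i i) = 1"
proof -
  let ?c = "\<lambda>x w u. chain_state (1 + k + m) ((x * d ^ k + w) * d ^ m + u) ((x * d ^ k + w) * d ^ m + u)"
  have d: "d ^ m > 0" using d_ge_1 by simp
  have "(\<Sum>i<d * d ^ m. glue m (gap_channel k) i i) = (\<Sum>x<d. \<Sum>u<d ^ m. \<Sum>w<d ^ k. ?c x w u)"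
    unfolding sum_lessThan_mult
    by (intro sum.cong refl, subst glue_gap) (auto simp: mult_add_less)
  also have "\<dots> = (\<Sum>x<d. \<Sum>w<d ^ k. \<Sum>u<d ^ m. ?c x w u)" by (intro sum.cong refl sum.swap)
  also have "\<dots> = (\<Sum>i<d * d ^ k * d ^ m. chain_state (1 + k + m) i i)"
    unfolding sum_lessThan_mult ..
  also have "d * d ^ k * d ^ m = d ^ (1 + k + m)" by (simp add: power_add)
  finally show ?thesis unfolding chain_state_trace .
qed

end

section \<open>Exponential decay\<close>

lemma smult_pow_mat:
  fixes A :: "'a :: comm_ring_1 mat"
  assumes A: "A \<in> carrier_mat n n"
  shows "(c \<cdot>\<^sub>m A) ^\<^sub>m k = c ^ k \<cdot>\<^sub>m (A ^\<^sub>m k)"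
proof (induction k)
  case 0
  show ?case using A by (intro eq_matI) auto
next
  case (Suc k)
  have Ak: "A ^\<^sub>m k \<in> carrier_mat n n" using A by simp
  have "(c \<cdot>\<^sub>m A) ^\<^sub>m Suc k = (c ^ k \<cdot>\<^sub>m A ^\<^sub>m k) * (c \<cdot>\<^sub>m A)" by (simp add: Suc)
  also have "\<dots> = c ^ k \<cdot>\<^sub>m (A ^\<^sub>m k * (c \<cdot>\<^sub>m A))"
    by (rule mult_smult_assoc_mat[OF Ak]) (use A in auto)
  also have "\<dots> = c ^ k \<cdot>\<^sub>m (c \<cdot>\<^sub>m (A ^\<^sub>m k * A))"
    by (simp add: mult_smult_distrib[OF Ak A])
  also have "\<dots> = c ^ Suc k \<cdot>\<^sub>m (A ^\<^sub>m Suc k)"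
    using A Ak by (intro eq_matI) (auto simp: mult_ac)
  finally show ?case .
qed

lemma mult_mat_vec_sum:
  assumes "A \<in> carrier_mat n m" "v \<in> carrier_vec m" "i < n"
  shows "(A *\<^sub>v v) $ i = (\<Sum>q<m. A $$ (i, q) * v $ q)"
  using assms by (auto simp: scalar_prod_def lessThan_atLeast0 intro!: sum.cong)

text \<open>Dividing by a number strictly between the spectral radius and 1 leaves a matrix of
  spectral radius below 1, whose powers are bounded. The margin absorbs the polynomial factors of
  Jordan blocks.\<close>

lemma pow_mat_decay:
  fixes A :: "complex mat"
  assumes A: "A \<in> carrier_mat n n" and n: "n > 0"
    and ev: "\<And>v z. v \<in> carrier_vec n \<Longrightarrow> v \<noteq> 0\<^sub>v n \<Longrightarrow> A *\<^sub>v v = z \<cdot>\<^sub>v v \<Longrightarrow> cmod z < 1"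
  shows "\<exists>C \<mu>. 0 < \<mu> \<and> \<mu> < 1 \<and> (\<forall>k i j. i < n \<longrightarrow> j < n \<longrightarrow> cmod ((A ^\<^sub>m k) $$ (i, j)) \<le> C * \<mu> ^ k)"
proof -
  define r where "r = spectral_radius A"
  obtain z where z: "z \<in> spectrum A" "r = cmod z"
    using spectral_radius_mem_max(1)[OF A n] by (auto simp: r_def)
  have r0: "0 \<le> r" and r1: "r < 1"
    using z A ev by (auto simp: spectrum_def eigenvalue_def eigenvector_def)
  \<comment> \<open>The midpoint is positive even for \<open>r = 0\<close>, so division by it is
    possible.\<close>
  define \<mu> where "\<mu> = (1 + r) / 2"
  have \<mu>: "0 < \<mu>" "\<mu> < 1" "r < \<mu>" using r0 r1 by (auto simp: \<mu>_def)
  define B where "B = complex_of_real (1 / \<mu>) \<cdot>\<^sub>m A"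
  have B: "B \<in> carrier_mat n n" using A by (simp add: B_def)
  have AB: "A = complex_of_real \<mu> \<cdot>\<^sub>m B"
    using A \<mu> by (intro eq_matI) (auto simp: B_def)
  have "spectral_radius B < 1"
  proof -
    obtain y where y: "y \<in> spectrum B" "spectral_radius B = cmod y"
      using spectral_radius_mem_max(1)[OF B n] by auto
    then obtain v where v: "v \<in> carrier_vec n" "v \<noteq> 0\<^sub>v n" "B *\<^sub>v v = y \<cdot>\<^sub>v v"
      using B by (auto simp: spectrum_def eigenvalue_def eigenvector_def)
    have "A *\<^sub>v v = (complex_of_real \<mu> * y) \<cdot>\<^sub>v v"
    proof -
      have "A *\<^sub>v v = complex_of_real \<mu> \<cdot>\<^sub>v (B *\<^sub>v v)"
        unfolding AB using B v(1) by (intro eq_vecI) auto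
      thus ?thesis using v by (simp add: smult_smult_assoc)
    qed
    hence "complex_of_real \<mu> * y \<in> spectrum A"
      using v A by (auto simp: spectrum_def eigenvalue_def eigenvector_def)
    hence "cmod (complex_of_real \<mu> * y) \<le> r"
      using spectral_radius_mem_max(2)[OF A n] by (auto simp: r_def)
    hence "\<mu> * cmod y \<le> r" using \<mu> by (simp add: norm_mult)
    hence "\<mu> * cmod y < \<mu> * 1" using \<mu> by linarith
    thus ?thesis using \<mu> y by (simp only: mult_less_cancel_left_pos)
  qed
  from spectral_radius_jnf_norm_bound_less_1_upper_triangular[OF B this]
  obtain C where C: "\<And>k. norm_bound (B ^\<^sub>m k) C" by blast
  have "cmod ((A ^\<^sub>m k) $$ (i, j)) \<le> C * \<mu> ^ k" if "i < n" "j < n" for k i j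
  proof -
    have "(A ^\<^sub>m k) $$ (i, j) = complex_of_real (\<mu> ^ k) * (B ^\<^sub>m k) $$ (i, j)"
      unfolding AB smult_pow_mat[OF B] using that B by simp
    moreover have "cmod ((B ^\<^sub>m k) $$ (i, j)) \<le> C"
      using C[of k] that B by (auto simp: norm_bound_def)
    ultimately show ?thesis using \<mu> by (simp add: norm_mult norm_power mult.commute mult_left_mono)
  qed
  thus ?thesis using \<mu> by blast
qed

lemma sum_squared_le:
  fixes f :: "'i \<Rightarrow> real"
  shows "(\<Sum>i\<in>I. f i)\<^sup>2 \<le> real (card I) * (\<Sum>i\<in>I. (f i)\<^sup>2)"
proof -
  have "(\<Sum>i\<in>I. f i)\<^sup>2 = (\<Sum>i\<in>I. \<Sum>j\<in>I. f i * f j)"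
    by (simp add: power2_eq_square sum_product)
  also have "\<dots> \<le> (\<Sum>i\<in>I. \<Sum>j\<in>I. ((f i)\<^sup>2 + (f j)\<^sup>2) / 2)"
  proof (intro sum_mono)
    fix i j
    show "f i * f j \<le> ((f i)\<^sup>2 + (f j)\<^sup>2) / 2" using sum_squares_bound[of "f i" "f j"] by simp
  qed
  also have "\<dots> = real (card I) * (\<Sum>i\<in>I. (f i)\<^sup>2)"
    by (simp add: sum_divide_distrib[symmetric] sum.distrib sum_distrib_left[symmetric])
  finally show ?thesis .
qed

text \<open>Write the kernel as \<open>(f - g) + \<epsilon> g\<close>. By Cauchy-Schwarz the form of
  \<open>f - g\<close> has modulus at most \<open>\<delta> * card I\<close> times the squared norm
  of \<open>x\<close>, and coercivity of \<open>g\<close> compensates this.\<close>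

lemma psd_perturbation:
  fixes \<delta> \<epsilon> l :: real
  assumes f: "psd I f" and g: "psd I g"
    and close: "\<And>i j. i \<in> I \<Longrightarrow> j \<in> I \<Longrightarrow> cmod (f i j - g i j) \<le> \<delta>" and \<delta>: "0 \<le> \<delta>"
    and coercive: "\<And>x. l * (\<Sum>i\<in>I. (cmod (x i))\<^sup>2) \<le> Re (\<Sum>i\<in>I. \<Sum>j\<in>I. cnj (x i) * g i j * x j)"
    and \<epsilon>: "\<delta> * real (card I) \<le> \<epsilon> * l" "0 \<le> \<epsilon>"
  shows "psd I (\<lambda>i j. f i j - complex_of_real (1 - \<epsilon>) * g i j)"
  unfolding psd_def
proof
  fix x
  let ?q = "\<lambda>h. \<Sum>i\<in>I. \<Sum>j\<in>I. cnj (x i) * h i j * x j"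
  let ?s = "\<Sum>i\<in>I. (cmod (x i))\<^sup>2"
  have e: "?q (\<lambda>i j. f i j - complex_of_real (1 - \<epsilon>) * g i j) =
      ?q (\<lambda>i j. f i j - g i j) + complex_of_real \<epsilon> * ?q g"
    unfolding sum_distrib_left sum.distrib[symmetric] by (intro sum.cong refl) (simp add: algebra_simps)
  have e': "?q (\<lambda>i j. f i j - g i j) = ?q f - ?q g"
    unfolding sum_subtractf[symmetric] by (intro sum.cong refl) (simp add: algebra_simps)
  have pos: "0 \<le> ?q f" "0 \<le> ?q g" using f g by (auto simp: psd_def)
  \<comment> \<open>The order on complex numbers also asks for a real value, which is inherited from
    the forms of \<open>f\<close> and \<open>g\<close>.\<close>
  have im: "Im (?q (\<lambda>i j. f i j - complex_of_real (1 - \<epsilon>) * g i j)) = 0"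
    unfolding e e' using pos by (simp only: less_eq_complex_def Im_complex_of_real minus_complex.sel
      plus_complex.sel times_complex.sel) simp
  have "cmod (?q (\<lambda>i j. f i j - g i j)) \<le> (\<Sum>i\<in>I. \<Sum>j\<in>I. \<delta> * (cmod (x i) * cmod (x j)))"
  proof (intro order_trans[OF norm_sum] sum_mono)
    fix i j assume "i \<in> I" "j \<in> I"
    from mult_right_mono[OF close[OF this], of "cmod (x i) * cmod (x j)"]
    show "cmod (cnj (x i) * (f i j - g i j) * x j) \<le> \<delta> * (cmod (x i) * cmod (x j))"
      by (simp add: norm_mult mult_ac)
  qed
  also have "\<dots> = \<delta> * (\<Sum>i\<in>I. cmod (x i))\<^sup>2"
    unfolding power2_eq_square sum_product by (simp only: sum_distrib_left)
  also have "\<dots> \<le> \<delta> * (real (card I) * ?s)"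
    using \<delta> by (intro mult_left_mono sum_squared_le)
  also have "\<dots> \<le> \<epsilon> * l * ?s"
    using mult_right_mono[OF \<epsilon>(1), of ?s] by (simp add: sum_nonneg mult.assoc)
  also have "\<dots> \<le> \<epsilon> * Re (?q g)"
    using mult_left_mono[OF coercive[of x] \<epsilon>(2)] by (simp only: mult.assoc)
  finally have "- Re (?q (\<lambda>i j. f i j - g i j)) \<le> \<epsilon> * Re (?q g)"
    using abs_Re_le_cmod[of "?q (\<lambda>i j. f i j - g i j)"] by linarith
  hence "0 \<le> Re (?q (\<lambda>i j. f i j - complex_of_real (1 - \<epsilon>) * g i j))"
    unfolding e by (simp only: plus_complex.sel times_complex.sel Re_complex_of_real Im_complex_of_real)
  thus "0 \<le> ?q (\<lambda>i j. f i j - complex_of_real (1 - \<epsilon>) * g i j)"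
    using im by (simp only: less_eq_complex_def zero_complex.sel)
qed

section \<open>Spectrum of the transfer matrix and strict positivity of the limit\<close>

context pure_fcs
begin

lemma fcs_Ehat_index:
  assumes B: "B \<in> carrier_mat b b" and ij: "i < b" "j < b"
  shows "fcs_Ehat d V B $$ (i, j) =
    (\<Sum>x<d. \<Sum>t<b. \<Sum>t'<b. V $$ (i, x * b + t) * B $$ (t, t') * cnj (V $$ (j, x * b + t')))"
proof -
  let ?K = "kron (1\<^sub>m d) B"
  have K: "?K \<in> carrier_mat (d * b) (d * b)" using B by (auto simp: kron_def)
  have Kx: "?K $$ (x * b + t, y * b + t') = (if x = y then B $$ (t, t') else 0)"
    if "x < d" "y < d" "t < b" "t' < b" for x y t t'
    using that B mult_add_less[OF that(1,3)] mult_add_less[OF that(2,4)] by (auto simp: kron_def)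
  have VK: "(V * ?K) $$ (i, y * b + t') = (\<Sum>t<b. V $$ (i, y * b + t) * B $$ (t, t'))"
    if "y < d" "t' < b" for y t'
  proof -
    have "(V * ?K) $$ (i, y * b + t') = (\<Sum>x<d. \<Sum>t<b. V $$ (i, x * b + t) * ?K $$ (x * b + t, y * b + t'))"
      unfolding mat_mult_index[OF V_carrier K ij(1) mult_add_less[OF that]] by (rule sum_lessThan_mult)
    also have "\<dots> = (\<Sum>x<d. if x = y then (\<Sum>t<b. V $$ (i, x * b + t) * B $$ (t, t')) else 0)"
      using that by (intro sum.cong refl) (auto simp: Kx)
    finally show ?thesis using that by simp
  qed
  have "fcs_Ehat d V B $$ (i, j) = (\<Sum>q<d * b. (V * ?K) $$ (i, q) * mat_adjoint V $$ (q, j))"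
    unfolding fcs_Ehat_def fcs_E_def
    by (rule mat_mult_index[OF mult_carrier_mat[OF V_carrier K] mat_adjoint_carrier[OF V_carrier] ij])
  also have "\<dots> = (\<Sum>x<d. \<Sum>t'<b. (V * ?K) $$ (i, x * b + t') * mat_adjoint V $$ (x * b + t', j))"
    by (rule sum_lessThan_mult)
  also have "\<dots> = (\<Sum>x<d. \<Sum>t'<b. \<Sum>t<b. V $$ (i, x * b + t) * B $$ (t, t') * cnj (V $$ (j, x * b + t')))"
  proof (intro sum.cong refl)
    fix x t' assume "x \<in> {..<d}" "t' \<in> {..<b}"
    hence "x < d" "t' < b" by auto
    moreover have "mat_adjoint V $$ (x * b + t', j) = cnj (V $$ (j, x * b + t'))"
      using calculation mult_add_less[of x d t' b] V_carrier ij by (intro mat_adjoint_index) auto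
    ultimately show "(V * ?K) $$ (i, x * b + t') * mat_adjoint V $$ (x * b + t', j) =
        (\<Sum>t<b. V $$ (i, x * b + t) * B $$ (t, t') * cnj (V $$ (j, x * b + t')))"
      by (simp only: VK sum_distrib_right)
  qed
  also have "\<dots> = (\<Sum>x<d. \<Sum>t<b. \<Sum>t'<b. V $$ (i, x * b + t) * B $$ (t, t') * cnj (V $$ (j, x * b + t')))"
    by (intro sum.cong refl sum.swap)
  finally show ?thesis .
qed

lemma fcs_Ehat_carrier: "B \<in> carrier_mat b b \<Longrightarrow> fcs_Ehat d V B \<in> carrier_mat b b"
  using V_carrier by (auto simp: fcs_Ehat_def fcs_E_def)

text \<open>Invariance tested on the matrix unit with its 1 at \<open>(c', c)\<close>: the dual map
  fixes \<open>\<rho>\<close>.\<close>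

lemma rho_fixed:
  assumes "c < b" "c' < b"
  shows "(\<Sum>r<b. \<Sum>r'<b. \<rho> $$ (r, r') * (\<Sum>x<d. cnj (V $$ (r, x * b + c)) * V $$ (r', x * b + c'))) = \<rho> $$ (c, c')"
proof -
  define B :: "complex mat" where "B = mat b b (\<lambda>(i, j). if i = c' then if j = c then 1 else 0 else 0)"
  have B: "B \<in> carrier_mat b b" by (simp add: B_def)
  have tr: "mat_trace (\<rho> * X) = (\<Sum>r<b. \<Sum>r'<b. \<rho> $$ (r, r') * X $$ (r', r))" if X: "X \<in> carrier_mat b b" for X
    unfolding mat_trace_def using rho_carrier by (auto intro!: sum.cong simp: mat_mult_index[OF rho_carrier X]
      simp del: index_mult_mat(1))
  have E: "fcs_Ehat d V B $$ (r', r) = (\<Sum>x<d. cnj (V $$ (r, x * b + c)) * V $$ (r', x * b + c'))"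
    if "r < b" "r' < b" for r r'
  proof -
    have "fcs_Ehat d V B $$ (r', r) = (\<Sum>x<d. \<Sum>t<b. \<Sum>t'<b. if t' = c then if t = c' then
        V $$ (r', x * b + t) * cnj (V $$ (r, x * b + t')) else 0 else 0)"
      unfolding fcs_Ehat_index[OF B that(2,1)]
      by (intro sum.cong refl) (auto simp: B_def)
    thus ?thesis using assms by (simp add: mult.commute)
  qed
  have "mat_trace (\<rho> * fcs_Ehat d V B) = mat_trace (\<rho> * B)"
    using rho_invariant B by (simp add: fcs_invariant_def)
  moreover have "mat_trace (\<rho> * B) = (\<Sum>r<b. \<Sum>r'<b. if r' = c' then if r = c then \<rho> $$ (r, r') else 0 else 0)"
    unfolding tr[OF B] by (intro sum.cong refl) (auto simp: B_def)
  ultimately show ?thesis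
    unfolding tr[OF fcs_Ehat_carrier[OF B]] using assms by (simp add: E)
qed

text \<open>From \<open>x y \<le> (x^2 + y^2) / 2\<close> and the normalization of word rows.
  Independence of \<open>k\<close> is the point: it rules out eigenvalues outside the unit
  disc.\<close>

lemma gap_channel_le_1:
  assumes "a < b" "c < b" "a' < b" "c' < b"
  shows "cmod (gap_channel k (a, c) (a', c')) \<le> 1"
proof -
  have row: "(\<Sum>w<d ^ k. (cmod (W k w r s))\<^sup>2) \<le> 1" if "r < b" "s < b" for r s
  proof -
    have "complex_of_real (\<Sum>w<d ^ k. \<Sum>t<b. (cmod (W k w r t))\<^sup>2) = 1"
      using word_orthonormal_rows[OF that(1,1), of k]
      by (simp add: complex_norm_square mult.commute del: of_real_power)
    hence "(\<Sum>w<d ^ k. \<Sum>t<b. (cmod (W k w r t))\<^sup>2) = 1" by (simp only: of_real_eq_1_iff)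
    moreover have "(\<Sum>w<d ^ k. (cmod (W k w r s))\<^sup>2) \<le> (\<Sum>w<d ^ k. \<Sum>t<b. (cmod (W k w r t))\<^sup>2)"
      using that by (intro sum_mono member_le_sum[of s "{..<b}" "\<lambda>t. (cmod (W k _ r t))\<^sup>2"]) auto
    ultimately show ?thesis by simp
  qed
  have "cmod (gap_channel k (a, c) (a', c')) \<le> (\<Sum>w<d ^ k. cmod (W k w a c) * cmod (W k w a' c'))"
    unfolding gap_channel_def by (rule order_trans[OF norm_sum]) (simp add: norm_mult)
  also have "\<dots> \<le> (\<Sum>w<d ^ k. ((cmod (W k w a c))\<^sup>2 + (cmod (W k w a' c'))\<^sup>2) / 2)"
  proof (rule sum_mono)
    fix w
    show "cmod (W k w a c) * cmod (W k w a' c') \<le> ((cmod (W k w a c))\<^sup>2 + (cmod (W k w a' c'))\<^sup>2) / 2"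
      using sum_squares_bound[of "cmod (W k w a c)" "cmod (W k w a' c')"] by simp
  qed
  also have "\<dots> = ((\<Sum>w<d ^ k. (cmod (W k w a c))\<^sup>2) + (\<Sum>w<d ^ k. (cmod (W k w a' c'))\<^sup>2)) / 2"
    by (simp add: sum_divide_distrib[symmetric] sum.distrib)
  also have "\<dots> \<le> 1" using row[OF assms(1,2)] row[OF assms(3,4)] by simp
  finally show ?thesis .
qed

text \<open>The matrix of \<open>fcs_Ehat\<close> on \<open>B\<close> flattened so that the entry \<open>(a', a)\<close> sits at \<open>a * b + a'\<close>; the first
  coordinate belongs to the conjugated factor.\<close>

definition transfer :: "complex mat" where
  "transfer = mat (b * b) (b * b) (\<lambda>(p, q). \<Sum>x<d. cnj (V $$ (p div b, x * b + q div b)) * V $$ (p mod b, x * b + q mod b))"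

text \<open>In the same flattening, the map \<open>B \<mapsto> Tr(\<rho> B) 1\<close>, the expected
  limit of the powers of \<open>transfer\<close>.\<close>

definition transfer_limit :: "complex mat" where
  "transfer_limit = mat (b * b) (b * b) (\<lambda>(p, q). if p div b = p mod b then \<rho> $$ (q div b, q mod b) else 0)"

lemma transfer_carrier [simp]:
  "transfer \<in> carrier_mat (b * b) (b * b)" "transfer_limit \<in> carrier_mat (b * b) (b * b)"
  by (simp_all add: transfer_def transfer_limit_def)

lemma transfer_index:
  assumes "a < b" "a' < b" "c < b" "c' < b"
  shows "transfer $$ (a * b + a', c * b + c') = (\<Sum>x<d. cnj (V $$ (a, x * b + c)) * V $$ (a', x * b + c'))"
    "transfer_limit $$ (a * b + a', c * b + c') = (if a = a' then \<rho> $$ (c, c') else 0)"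
  using assms mult_add_less[OF assms(1,2)] mult_add_less[OF assms(3,4)]
  by (auto simp: transfer_def transfer_limit_def)

lemma pair_index_cases:
  assumes "p < b * b"
  obtains a a' where "p = a * b + a'" "a < b" "a' < b"
  by (rule that[of "p div b" "p mod b"]) (use assms b_ge_1 in \<open>simp_all add: less_mult_imp_div_less\<close>)

lemma pair_mult_index:
  assumes "A \<in> carrier_mat n (b * b)" "B \<in> carrier_mat (b * b) m" "i < n" "j < m"
  shows "(A * B) $$ (i, j) = (\<Sum>e<b. \<Sum>e'<b. A $$ (i, e * b + e') * B $$ (e * b + e', j))"
  unfolding mat_mult_index[OF assms] by (rule sum_lessThan_mult)

text \<open>The limit map takes scalar values, and \<open>fcs_Ehat\<close> is unital.\<close>

lemma transfer_mult_limit: "transfer * transfer_limit = transfer_limit"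
proof (rule eq_matI)
  fix p q assume "p < dim_row transfer_limit" "q < dim_col transfer_limit"
  hence pq: "p < b * b" "q < b * b" by (auto simp: transfer_limit_def)
  obtain a a' c c' where p: "p = a * b + a'" "a < b" "a' < b" and q: "q = c * b + c'" "c < b" "c' < b"
    using pq pair_index_cases by metis
  have "(transfer * transfer_limit) $$ (p, q) =
      (\<Sum>e<b. \<Sum>e'<b. if e' = e then (\<Sum>x<d. cnj (V $$ (a, x * b + e)) * V $$ (a', x * b + e')) * \<rho> $$ (c, c') else 0)"
    unfolding pair_mult_index[OF transfer_carrier pq] unfolding p(1) q(1)
    using p q by (intro sum.cong refl) (auto simp: transfer_index)
  also have "\<dots> = (\<Sum>e<b. \<Sum>x<d. V $$ (a', x * b + e) * cnj (V $$ (a, x * b + e))) * \<rho> $$ (c, c')"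
    by (simp add: sum_distrib_right[symmetric] sum_distrib_left[symmetric] mult.commute)
  also have "(\<Sum>e<b. \<Sum>x<d. V $$ (a', x * b + e) * cnj (V $$ (a, x * b + e))) = (if a' = a then 1 else 0)"
    by (subst sum.swap) (rule V_orthonormal_rows[OF p(3,2)])
  finally show "(transfer * transfer_limit) $$ (p, q) = transfer_limit $$ (p, q)"
    using p q by (auto simp: transfer_index)
qed (auto simp: transfer_def transfer_limit_def)

text \<open>The functional \<open>B \<mapsto> Tr(\<rho> B)\<close> is invariant.\<close>

lemma limit_mult_transfer: "transfer_limit * transfer = transfer_limit"
proof (rule eq_matI)
  fix p q assume "p < dim_row transfer_limit" "q < dim_col transfer_limit"
  hence pq: "p < b * b" "q < b * b" by (auto simp: transfer_limit_def)
  obtain a a' c c' where p: "p = a * b + a'" "a < b" "a' < b" and q: "q = c * b + c'" "c < b" "c' < b"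
    using pq pair_index_cases by metis
  have "(transfer_limit * transfer) $$ (p, q) = (if a = a' then
      (\<Sum>e<b. \<Sum>e'<b. \<rho> $$ (e, e') * (\<Sum>x<d. cnj (V $$ (e, x * b + c)) * V $$ (e', x * b + c'))) else 0)"
    unfolding pair_mult_index[OF transfer_carrier(2,1) pq] unfolding p(1) q(1)
    using p q by (auto simp: transfer_index intro!: sum.cong)
  thus "(transfer_limit * transfer) $$ (p, q) = transfer_limit $$ (p, q)"
    using p q by (simp add: transfer_index rho_fixed)
qed (auto simp: transfer_def transfer_limit_def)

lemma limit_mult_limit: "transfer_limit * transfer_limit = transfer_limit"
proof (rule eq_matI)
  fix p q assume "p < dim_row transfer_limit" "q < dim_col transfer_limit"
  hence pq: "p < b * b" "q < b * b" by (auto simp: transfer_limit_def)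
  obtain a a' c c' where p: "p = a * b + a'" "a < b" "a' < b" and q: "q = c * b + c'" "c < b" "c' < b"
    using pq pair_index_cases by metis
  have "(transfer_limit * transfer_limit) $$ (p, q) = 
      (\<Sum>e<b. \<Sum>e'<b. if e' = e then if a = a' then \<rho> $$ (e, e') * \<rho> $$ (c, c') else 0 else 0)"
    unfolding pair_mult_index[OF transfer_carrier(2,2) pq] unfolding p(1) q(1)
    using p q by (intro sum.cong refl) (auto simp: transfer_index)
  also have "\<dots> = (if a = a' then (\<Sum>e<b. \<rho> $$ (e, e)) * \<rho> $$ (c, c') else 0)"
    by (simp add: sum_distrib_right)
  finally show "(transfer_limit * transfer_limit) $$ (p, q) = transfer_limit $$ (p, q)"
    using p q by (simp add: transfer_index rho_trace)
qed (auto simp: transfer_def transfer_limit_def)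

text \<open>The same numbers in two groupings: rows \<open>(a, a')\<close> against columns
  \<open>(c, c')\<close> make composition a matrix product, while \<open>(a, c)\<close> against
  \<open>(a', c')\<close> makes complete positivity visible. Spectral estimates for one thus apply
  to the other.\<close>

lemma transfer_pow_index:
  assumes "a < b" "a' < b" "c < b" "c' < b"
  shows "(transfer ^\<^sub>m k) $$ (a * b + a', c * b + c') = gap_channel k (a, c) (a', c')"
  using assms(3,4)
proof (induction k arbitrary: c c')
  case 0
  have "a * b + a' = c * b + c' \<longleftrightarrow> a = c \<and> a' = c'"
  proof
    assume e: "a * b + a' = c * b + c'"
    show "a = c \<and> a' = c'"
      using arg_cong[OF e, of "\<lambda>x. x div b"] arg_cong[OF e, of "\<lambda>x. x mod b"] assms(1,2) 0 by simp
  qed simp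
  thus ?case
    using mult_add_less[OF assms(1,2)] mult_add_less[OF 0]
    by (simp add: gap_channel_def carrier_matD[OF transfer_carrier(1)])
next
  case (Suc k)
  let ?K = "\<lambda>w e e'. cnj (W k w a e) * W k w a' e'"
  let ?S = "\<lambda>x e e'. cnj (V $$ (e, x * b + c)) * V $$ (e', x * b + c')"
  have "(transfer ^\<^sub>m Suc k) $$ (a * b + a', c * b + c') =
      (\<Sum>e<b. \<Sum>e'<b. (\<Sum>w<d ^ k. ?K w e e') * (\<Sum>x<d. ?S x e e'))"
    unfolding pow_mat.simps
      pair_mult_index[OF pow_carrier_mat[OF transfer_carrier(1)] transfer_carrier(1) mult_add_less[OF assms(1,2)] mult_add_less[OF Suc.prems]]
    using Suc.prems assms(1,2)
    by (intro sum.cong refl) (auto simp: Suc.IH transfer_index gap_channel_def)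
  also have "\<dots> = (\<Sum>e<b. \<Sum>e'<b. \<Sum>w<d ^ k. \<Sum>x<d. ?K w e e' * ?S x e e')"
    by (simp only: sum_product)
  also have "\<dots> = (\<Sum>e<b. \<Sum>w<d ^ k. \<Sum>e'<b. \<Sum>x<d. ?K w e e' * ?S x e e')" by (intro sum.cong refl sum.swap)
  also have "\<dots> = (\<Sum>w<d ^ k. \<Sum>e<b. \<Sum>e'<b. \<Sum>x<d. ?K w e e' * ?S x e e')" by (rule sum.swap)
  also have "\<dots> = (\<Sum>w<d ^ k. \<Sum>e<b. \<Sum>x<d. \<Sum>e'<b. ?K w e e' * ?S x e e')" by (intro sum.cong refl sum.swap)
  also have "\<dots> = (\<Sum>w<d ^ k. \<Sum>x<d. \<Sum>e<b. \<Sum>e'<b. ?K w e e' * ?S x e e')" by (intro sum.cong refl sum.swap)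
  also have "\<dots> = gap_channel (Suc k) (a, c) (a', c')"
  proof -
    have "gap_channel (Suc k) (a, c) (a', c') =
        (\<Sum>w<d ^ k. \<Sum>x<d. (\<Sum>e<b. cnj (W k w a e * V $$ (e, x * b + c))) * (\<Sum>e'<b. W k w a' e' * V $$ (e', x * b + c')))"
      unfolding gap_channel_def power_Suc2 sum_lessThan_mult by (intro sum.cong refl) simp
    thus ?thesis unfolding sum_product
      by (simp only: complex_cnj_mult mult_ac)
  qed
  finally show ?case .
qed

text \<open>The condition on \<open>transfer_limit\<close> excludes the fixed point 1. An eigenvalue
  outside the unit disc would make the entries of the powers unbounded; on the circle,
  \<open>peripheral_trivial\<close> leaves only scalar matrices \<open>c 1\<close>, for which the
  condition reads \<open>c = 0\<close>.\<close>

lemma transfer_eigenvalue: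
  assumes v: "v \<in> carrier_vec (b * b)" "v \<noteq> 0\<^sub>v (b * b)"
    and ev: "transfer *\<^sub>v v = z \<cdot>\<^sub>v v" and lim: "transfer_limit *\<^sub>v v = 0\<^sub>v (b * b)"
  shows "cmod z < 1"
proof (rule ccontr)
  assume "\<not> cmod z < 1"
  then consider "cmod z > 1" | "cmod z = 1" by linarith
  thus False
  proof cases
    case 1
    obtain p where p: "p < b * b" "v $ p \<noteq> 0"
      using v by (metis carrier_vecD eq_vecI index_zero_vec(1) index_zero_vec(2))
    let ?S = "\<Sum>q<b * b. cmod (v $ q)"
    \<comment> \<open>For this \<open>k\<close> the entry of \<open>z^k v\<close> at
      \<open>p\<close> exceeds \<open>?S\<close> in modulus, but a matrix with entries of modulus at
      most 1 cannot map \<open>v\<close> that far.\<close>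
    obtain k where k: "?S / cmod (v $ p) < cmod z ^ k" using real_arch_pow[OF 1] by blast
    have "transfer ^\<^sub>m k *\<^sub>v v = z ^ k \<cdot>\<^sub>v v"
      using eigenvector_pow[OF transfer_carrier(1), of v z k] v ev by (simp add: eigenvector_def transfer_def)
    hence "z ^ k * v $ p = (transfer ^\<^sub>m k *\<^sub>v v) $ p" using p v by simp
    also have "\<dots> = (\<Sum>q<b * b. (transfer ^\<^sub>m k) $$ (p, q) * v $ q)"
      by (rule mult_mat_vec_sum[OF pow_carrier_mat[OF transfer_carrier(1)] v(1) p(1)])
    finally have pow: "z ^ k * v $ p = (\<Sum>q<b * b. (transfer ^\<^sub>m k) $$ (p, q) * v $ q)" .
    have "cmod z ^ k * cmod (v $ p) = cmod (z ^ k * v $ p)" by (simp only: norm_mult norm_power)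
    also have "\<dots> \<le> (\<Sum>q<b * b. 1 * cmod (v $ q))"
      unfolding pow
    proof (intro order_trans[OF norm_sum] sum_mono)
      fix q assume "q \<in> {..<b * b}"
      hence q: "q < b * b" by simp
      obtain a a' c c' where "p = a * b + a'" "a < b" "a' < b" "q = c * b + c'" "c < b" "c' < b"
        using p(1) q pair_index_cases by metis
      hence "cmod ((transfer ^\<^sub>m k) $$ (p, q)) \<le> 1"
        by (simp add: transfer_pow_index gap_channel_le_1)
      thus "cmod ((transfer ^\<^sub>m k) $$ (p, q) * v $ q) \<le> 1 * cmod (v $ q)"
        unfolding norm_mult by (rule mult_right_mono) simp
    qed
    finally show False using k p by (simp add: field_simps)
  next
    case 2
    \<comment> \<open>Undoing the flattening turns \<open>v\<close> into an eigenvector of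
      \<open>fcs_Ehat\<close>.\<close>
    define B where "B = mat b b (\<lambda>(i, j). v $ (j * b + i))"
    have B: "B \<in> carrier_mat b b" by (simp add: B_def)
    have Tv: "(A *\<^sub>v v) $ p = (\<Sum>e<b. \<Sum>e'<b. A $$ (p, e * b + e') * v $ (e * b + e'))"
      if "A \<in> carrier_mat (b * b) (b * b)" "p < b * b" for A p
      unfolding mult_mat_vec_sum[OF that(1) v(1) that(2)] by (rule sum_lessThan_mult)
    have "fcs_Ehat d V B = z \<cdot>\<^sub>m B"
    proof (rule eq_matI)
      fix i j assume "i < dim_row (z \<cdot>\<^sub>m B)" "j < dim_col (z \<cdot>\<^sub>m B)"
      hence ij: "i < b" "j < b" by (auto simp: B_def)
      let ?t = "\<lambda>x t t'. cnj (V $$ (j, x * b + t')) * V $$ (i, x * b + t) * v $ (t' * b + t)"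
      have "fcs_Ehat d V B $$ (i, j) = (\<Sum>x<d. \<Sum>t<b. \<Sum>t'<b. ?t x t t')"
        unfolding fcs_Ehat_index[OF B ij] by (intro sum.cong refl) (auto simp: B_def)
      also have "\<dots> = (\<Sum>x<d. \<Sum>t'<b. \<Sum>t<b. ?t x t t')" by (intro sum.cong refl sum.swap)
      also have "\<dots> = (\<Sum>t'<b. \<Sum>x<d. \<Sum>t<b. ?t x t t')" by (rule sum.swap)
      also have "\<dots> = (\<Sum>t'<b. \<Sum>t<b. \<Sum>x<d. ?t x t t')" by (intro sum.cong refl sum.swap)
      also have "\<dots> = (transfer *\<^sub>v v) $ (j * b + i)"
        unfolding Tv[OF transfer_carrier(1) mult_add_less[OF ij(2,1)]]
        using ij by (intro sum.cong refl) (auto simp: transfer_index sum_distrib_right)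
      also have "\<dots> = (z \<cdot>\<^sub>m B) $$ (i, j)"
        using ij v mult_add_less[OF ij(2,1)] by (simp add: ev B_def)
      finally show "fcs_Ehat d V B $$ (i, j) = (z \<cdot>\<^sub>m B) $$ (i, j)" .
    qed (use fcs_Ehat_carrier[OF B] B in auto)
    moreover have "B \<noteq> 0\<^sub>m b b"
    proof
      assume B0: "B = 0\<^sub>m b b"
      have "v = 0\<^sub>v (b * b)"
      proof (rule eq_vecI)
        fix p assume "p < dim_vec (0\<^sub>v (b * b) :: complex vec)"
        hence p: "p < b * b" by simp
        then obtain a a' where "p = a * b + a'" "a < b" "a' < b" by (rule pair_index_cases)
        thus "v $ p = 0\<^sub>v (b * b) $ p" using arg_cong[OF B0, of "\<lambda>X. X $$ (a', a)"] p by (simp add: B_def)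
      qed (use v in auto)
      thus False using v by simp
    qed
    ultimately obtain c where c: "B = c \<cdot>\<^sub>m 1\<^sub>m b" using peripheral_trivial[OF B _ 2] by blast
    have vc: "v $ (e * b + e') = (if e' = e then c else 0)" if "e < b" "e' < b" for e e'
      using arg_cong[OF c, of "\<lambda>X. X $$ (e', e)"] that by (auto simp: B_def)
    have b0: "0 < b" using b_ge_1 by simp
    \<comment> \<open>Index 0 is a diagonal position, where the limit map returns
      \<open>Tr(\<rho> B) = c\<close>.\<close>
    have "0 = (transfer_limit *\<^sub>v v) $ (0 * b + 0)" using b0 by (simp add: lim)
    also have "\<dots> = (\<Sum>e<b. \<Sum>e'<b. transfer_limit $$ (0 * b + 0, e * b + e') * v $ (e * b + e'))"
      by (rule Tv) (use b0 in auto)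
    also have "\<dots> = (\<Sum>e<b. \<Sum>e'<b. if e' = e then \<rho> $$ (e, e') * c else 0)"
      using b0 by (intro sum.cong refl) (auto simp only: transfer_index(2) vc lessThan_iff mult_zero_right split: if_splits)
    also have "\<dots> = (\<Sum>e<b. \<rho> $$ (e, e)) * c" by (simp add: sum_distrib_right)
    finally have "c = 0" by (simp add: rho_trace)
    thus False using \<open>B \<noteq> 0\<^sub>m b b\<close> c by (auto intro!: eq_matI)
  qed
qed

text \<open>With \<open>T\<close> and \<open>P\<close> for the transfer and limit matrices,
  \<open>T P = P T = P P = P\<close> cancels the mixed terms. At \<open>k = 0\<close> the left side
  would be the identity.\<close>

lemma transfer_minus_limit_pow:
  "1 \<le> k \<Longrightarrow> (transfer - transfer_limit) ^\<^sub>m k = transfer ^\<^sub>m k - transfer_limit"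
proof (induction k rule: nat_induct_at_least)
  case base
  show ?case by (simp add: transfer_def transfer_limit_def)
next
  case (Suc k)
  let ?n = "b * b"
  have T: "transfer ^\<^sub>m k \<in> carrier_mat ?n ?n" by (rule pow_carrier_mat) simp
  have TL: "transfer ^\<^sub>m j * transfer_limit = transfer_limit" for j
  proof (induction j)
    case (Suc j)
    have "transfer ^\<^sub>m Suc j * transfer_limit = transfer ^\<^sub>m j * (transfer * transfer_limit)"
      unfolding pow_mat.simps by (rule assoc_mult_mat[of _ ?n ?n _ ?n _ ?n]) (auto intro: pow_carrier_mat)
    thus ?case by (simp add: transfer_mult_limit Suc)
  qed (simp add: transfer_def left_mult_one_mat[OF transfer_carrier(2)])
  have "(transfer - transfer_limit) ^\<^sub>m Suc k = (transfer ^\<^sub>m k - transfer_limit) * (transfer - transfer_limit)"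
    by (simp add: Suc.IH)
  also have "\<dots> = transfer ^\<^sub>m k * (transfer - transfer_limit) - transfer_limit * (transfer - transfer_limit)"
    by (rule minus_mult_distrib_mat[OF T transfer_carrier(2) minus_carrier_mat[OF transfer_carrier(2)]])
  also have "transfer ^\<^sub>m k * (transfer - transfer_limit) = transfer ^\<^sub>m Suc k - transfer_limit"
    by (simp add: mult_minus_distrib_mat[OF T transfer_carrier] TL)
  also have "transfer_limit * (transfer - transfer_limit) = 0\<^sub>m ?n ?n"
    by (simp add: mult_minus_distrib_mat[OF transfer_carrier(2) transfer_carrier] limit_mult_transfer limit_mult_limit)
  finally show ?case
    by (intro eq_matI) (auto simp: transfer_def transfer_limit_def)
qed

lemma gap_channel_decay:
  "\<exists>C \<mu>. 0 < C \<and> 0 < \<mu> \<and> \<mu> < 1 \<and> (\<forall>k. \<forall>p\<in>{..<b} \<times> {..<b}. \<forall>q\<in>{..<b} \<times> {..<b}.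
    cmod (gap_channel k p q - limit_channel p q) \<le> C * \<mu> ^ k)"
proof -
  let ?n = "b * b" and ?N = "transfer - transfer_limit"
  have n: "?n > 0" using b_ge_1 by simp
  have N: "?N \<in> carrier_mat ?n ?n" by (auto intro: minus_carrier_mat)
  have ev: "cmod z < 1" if v: "v \<in> carrier_vec ?n" "v \<noteq> 0\<^sub>v ?n" "?N *\<^sub>v v = z \<cdot>\<^sub>v v" for v z
  proof (cases "z = 0")
    case False
    \<comment> \<open>The limit annihilates the range of \<open>?N\<close>, so for nonzero
      \<open>z\<close> it annihilates \<open>v\<close>, which is then an eigenvector of
      \<open>transfer\<close> itself.\<close>
    have "transfer_limit *\<^sub>v (?N *\<^sub>v v) = (transfer_limit * ?N) *\<^sub>v v"
      by (rule assoc_mult_mat_vec[OF transfer_carrier(2) N v(1), symmetric])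
    also have "transfer_limit * ?N = 0\<^sub>m ?n ?n"
      by (simp add: mult_minus_distrib_mat[OF transfer_carrier(2) transfer_carrier] limit_mult_transfer limit_mult_limit)
    also have "0\<^sub>m ?n ?n *\<^sub>v v = 0\<^sub>v ?n"
      using v(1) by (intro eq_vecI) (auto simp: scalar_prod_def)
    finally have "transfer_limit *\<^sub>v (z \<cdot>\<^sub>v v) = 0\<^sub>v ?n" using v(3) by simp
    hence "z \<cdot>\<^sub>v (transfer_limit *\<^sub>v v) = 0\<^sub>v ?n"
      by (simp add: mult_mat_vec[OF transfer_carrier(2) v(1)])
    hence lim: "transfer_limit *\<^sub>v v = 0\<^sub>v ?n"
    proof (intro eq_vecI)
      fix i assume "z \<cdot>\<^sub>v (transfer_limit *\<^sub>v v) = 0\<^sub>v ?n" "i < dim_vec (0\<^sub>v ?n :: complex vec)"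
      hence "z * (transfer_limit *\<^sub>v v) $ i = 0"
        by (metis dim_mult_mat_vec index_smult_vec(1) index_smult_vec(2) index_zero_vec(1) index_zero_vec(2))
      thus "(transfer_limit *\<^sub>v v) $ i = 0\<^sub>v ?n $ i"
        using False \<open>i < dim_vec (0\<^sub>v ?n :: complex vec)\<close> by simp
    qed (simp add: transfer_limit_def)
    have "?N *\<^sub>v v = transfer *\<^sub>v v - transfer_limit *\<^sub>v v"
      by (rule minus_mult_distrib_mat_vec[OF transfer_carrier v(1)])
    also have "\<dots> = transfer *\<^sub>v v"
      unfolding lim by (intro eq_vecI) (auto simp: carrier_matD[OF transfer_carrier(1)])
    finally have "transfer *\<^sub>v v = z \<cdot>\<^sub>v v" using v(3) by simp
    thus ?thesis using transfer_eigenvalue[OF v(1,2) _ lim] by simp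
  qed simp
  have "\<exists>C \<mu>. 0 < \<mu> \<and> \<mu> < 1 \<and> (\<forall>k i j. i < ?n \<longrightarrow> j < ?n \<longrightarrow> cmod ((?N ^\<^sub>m k) $$ (i, j)) \<le> C * \<mu> ^ k)"
    by (rule pow_mat_decay[OF N n]) (blast intro: ev)
  then obtain C \<mu> where \<mu>: "0 < \<mu>" "\<mu> < 1"
    and C: "\<And>k i j. i < ?n \<Longrightarrow> j < ?n \<Longrightarrow> cmod ((?N ^\<^sub>m k) $$ (i, j)) \<le> C * \<mu> ^ k"
    by blast
  let ?J = "{..<b} \<times> {..<b}"
  \<comment> \<open>\<open>D\<close> covers \<open>k = 0\<close>, where the power formula fails; the
    1 added to the constant below keeps it positive.\<close>
  define D where "D = (\<Sum>p\<in>?J. \<Sum>q\<in>?J. cmod (gap_channel 0 p q - limit_channel p q))"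
  have D0: "0 \<le> D" unfolding D_def by (intro sum_nonneg) auto
  have "cmod (gap_channel k p q - limit_channel p q) \<le> (\<bar>C\<bar> + D + 1) * \<mu> ^ k"
    if p: "p \<in> ?J" and q: "q \<in> ?J" for k p q
  proof (cases "k = 0")
    case True
    have "cmod (gap_channel 0 p q - limit_channel p q) \<le> (\<Sum>q\<in>?J. cmod (gap_channel 0 p q - limit_channel p q))"
      using q by (intro member_le_sum) auto
    also have "\<dots> \<le> D"
      unfolding D_def using p by (intro member_le_sum[of p ?J "\<lambda>p. \<Sum>q\<in>?J. cmod (gap_channel 0 p q - limit_channel p q)"])
        (auto intro: sum_nonneg)
    finally show ?thesis using True by simp
  next
    case False
    obtain a c a' c' where pq: "p = (a, c)" "q = (a', c')" "a < b" "c < b" "a' < b" "c' < b"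
      using p q by auto
    have "gap_channel k p q - limit_channel p q = (?N ^\<^sub>m k) $$ (a * b + a', c * b + c')"
      using False pq mult_add_less[OF pq(3,5)] mult_add_less[OF pq(4,6)] transfer_carrier(2)
      by (simp add: transfer_minus_limit_pow transfer_pow_index transfer_index limit_channel_def
        carrier_matD[OF transfer_carrier(2)])
    also have "cmod \<dots> \<le> C * \<mu> ^ k" by (rule C) (use pq in \<open>auto intro: mult_add_less\<close>)
    also have "\<dots> \<le> (\<bar>C\<bar> + D + 1) * \<mu> ^ k" using \<mu> D0 by (intro mult_right_mono) auto
    finally show ?thesis .
  qed
  moreover have "0 < \<bar>C\<bar> + D + 1" using D0 by simp
  ultimately show ?thesis using \<mu> by blast
qed

text \<open>The constant is the smallest eigenvalue of \<open>\<rho>\<close>, positive by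
  nonsingularity; passing to coordinates in an eigenbasis preserves the norm of
  \<open>x\<close>.\<close>

lemma rho_coercive:
  "\<exists>l>0. \<forall>x. l * (\<Sum>r<b. (cmod (x r))\<^sup>2) \<le> Re (\<Sum>r<b. \<Sum>r'<b. cnj (x r) * \<rho> $$ (r, r') * x r')"
proof -
  obtain U l where un: "unitary_mat b U"
    and mat: "mat b b (\<lambda>(i, j). \<rho> $$ (i, j)) = U * mat_diag b (\<lambda>i. complex_of_real (l i)) * mat_adjoint U"
    and \<rho>_eq: "\<And>i j. i < b \<Longrightarrow> j < b \<Longrightarrow>
      \<rho> $$ (i, j) = (\<Sum>q<b. U $$ (i, q) * complex_of_real (l q) * cnj (U $$ (j, q)))"
    and l0: "\<And>q. q < b \<Longrightarrow> 0 \<le> l q"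
    using psd_spectral[OF rho_psd] by blast
  have U: "U \<in> carrier_mat b b" using un by (simp add: unitary_mat_def)
  note U' = mat_adjoint_carrier[OF U]
  have "mat b b (\<lambda>(i, j). \<rho> $$ (i, j)) = \<rho>" using rho_carrier by (intro eq_matI) auto
  hence \<rho>U: "\<rho> = U * mat_diag b (\<lambda>i. complex_of_real (l i)) * mat_adjoint U" using mat by simp
  \<comment> \<open>An eigenvalue 0 would put a column of \<open>U\<close> into the kernel of
    \<open>\<rho>\<close>, and the inverse \<open>R\<close> would make this unit column
    vanish.\<close>
  have lpos: "0 < l q" if q: "q < b" for q
  proof (rule ccontr)
    assume "\<not> 0 < l q"
    hence lq: "l q = 0" using l0[OF q] by simp
    obtain R where R: "inverts_mat R \<rho>" "inverts_mat \<rho> R"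
      using rho_nonsingular by (auto simp: invertible_mat_def)
    have Rc: "R \<in> carrier_mat b b"
      using R rho_carrier unfolding inverts_mat_def
      by (metis carrier_matD(1) carrier_matD(2) carrier_matI index_mult_mat(2) index_mult_mat(3) index_one_mat(2) index_one_mat(3))
    hence R\<rho>: "R * \<rho> = 1\<^sub>m b" using R by (auto simp: inverts_mat_def)
    let ?D = "mat_diag b (\<lambda>i. complex_of_real (l i))"
    have "\<rho> * U = U * ?D * (mat_adjoint U * U)"
      unfolding \<rho>U using U U' by (intro assoc_mult_mat[of _ b b _ b _ b]) auto
    hence \<rho>UD: "\<rho> * U = U * ?D" using un U by (simp add: unitary_mat_def right_mult_one_mat[of _ b b])
    have "U = R * (\<rho> * U)"
      using assoc_mult_mat[OF Rc rho_carrier U] R\<rho> U by simp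
    have "U $$ (i, q) = 0" if i: "i < b" for i
    proof -
      have "U $$ (i, q) = (\<Sum>s<b. R $$ (i, s) * (\<rho> * U) $$ (s, q))"
        using mat_mult_index[OF Rc mult_carrier_mat[OF rho_carrier U] i q] \<open>U = R * (\<rho> * U)\<close> by simp
      also have "\<dots> = 0"
        unfolding \<rho>UD mat_diag_mult_right[OF U] using q lq by (intro sum.neutral) auto
      finally show ?thesis .
    qed
    hence "(\<Sum>i<b. cnj (U $$ (i, q)) * U $$ (i, q)) = 0" by (intro sum.neutral) auto
    thus False using unitary_mat_columns[OF un q q] by simp
  qed
  define m where "m = Min (l ` {..<b})"
  have ne: "l ` {..<b} \<noteq> {}" using b_ge_1 by (auto simp: lessThan_empty_iff)
  have m0: "0 < m" unfolding m_def using ne lpos by (subst Min_gr_iff) auto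
  have ml: "m \<le> l q" if "q < b" for q unfolding m_def using that by (intro Min_le) auto
  have "m * (\<Sum>r<b. (cmod (x r))\<^sup>2) \<le> Re (\<Sum>r<b. \<Sum>r'<b. cnj (x r) * \<rho> $$ (r, r') * x r')" for x
  proof -
    define y where "y q = (\<Sum>r<b. cnj (x r) * U $$ (r, q))" for q
    \<comment> \<open>Used twice: \<open>h\<close> constantly 1 gives Parseval's identity, and
      \<open>h = l\<close> diagonalizes the form of \<open>\<rho>\<close>.\<close>
    have form: "(\<Sum>r<b. \<Sum>r'<b. cnj (x r) * (\<Sum>q<b. U $$ (r, q) * complex_of_real (h q) * cnj (U $$ (r', q))) * x r') =
        complex_of_real (\<Sum>q<b. h q * (cmod (y q))\<^sup>2)" for h
    proof -
      let ?t = "\<lambda>r r' q. complex_of_real (h q) * ((cnj (x r) * U $$ (r, q)) * cnj (cnj (x r') * U $$ (r', q)))"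
      have "(\<Sum>r<b. \<Sum>r'<b. cnj (x r) * (\<Sum>q<b. U $$ (r, q) * complex_of_real (h q) * cnj (U $$ (r', q))) * x r') =
        (\<Sum>r<b. \<Sum>r'<b. \<Sum>q<b. ?t r r' q)"
        unfolding sum_distrib_left sum_distrib_right by (intro sum.cong refl) (simp add: mult_ac)
      also have "\<dots> = (\<Sum>r<b. \<Sum>q<b. \<Sum>r'<b. ?t r r' q)" by (intro sum.cong refl sum.swap)
      also have "\<dots> = (\<Sum>q<b. \<Sum>r<b. \<Sum>r'<b. ?t r r' q)" by (rule sum.swap)
      also have "\<dots> = (\<Sum>q<b. complex_of_real (h q) * (y q * cnj (y q)))"
        unfolding y_def cnj_sum by (simp only: sum_distrib_left[symmetric] sum_product)
      also have "\<dots> = complex_of_real (\<Sum>q<b. h q * (cmod (y q))\<^sup>2)"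
        by (simp add: complex_norm_square del: of_real_power)
      finally show ?thesis .
    qed
    have "(\<Sum>r<b. \<Sum>r'<b. cnj (x r) * (\<Sum>q<b. U $$ (r, q) * complex_of_real 1 * cnj (U $$ (r', q))) * x r') =
        (\<Sum>r<b. \<Sum>r'<b. if r' = r then cnj (x r) * x r' else 0)"
      by (intro sum.cong refl) (simp add: unitary_mat_rows[OF un])
    also have "\<dots> = complex_of_real (\<Sum>r<b. (cmod (x r))\<^sup>2)"
      by (simp add: complex_norm_square mult.commute del: of_real_power)
    finally have "complex_of_real (\<Sum>q<b. (cmod (y q))\<^sup>2) = complex_of_real (\<Sum>r<b. (cmod (x r))\<^sup>2)"
      unfolding form by simp
    hence parseval: "(\<Sum>q<b. (cmod (y q))\<^sup>2) = (\<Sum>r<b. (cmod (x r))\<^sup>2)" by (simp only: of_real_eq_iff)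
    have "(\<Sum>r<b. \<Sum>r'<b. cnj (x r) * \<rho> $$ (r, r') * x r') = complex_of_real (\<Sum>q<b. l q * (cmod (y q))\<^sup>2)"
      unfolding form[symmetric] by (intro sum.cong refl) (simp add: \<rho>_eq)
    moreover have "m * (\<Sum>r<b. (cmod (x r))\<^sup>2) \<le> (\<Sum>q<b. l q * (cmod (y q))\<^sup>2)"
      unfolding parseval[symmetric] sum_distrib_left using ml by (intro sum_mono mult_right_mono) auto
    ultimately show ?thesis by (simp only: Re_complex_of_real)
  qed
  thus ?thesis using m0 by blast
qed

text \<open>The kernel is block diagonal in the input with \<open>\<rho>\<close> in each block, so
  positivity and coercivity reduce to those of \<open>\<rho>\<close>.\<close>

lemma limit_channel_form:
  "(\<Sum>p\<in>{..<b} \<times> {..<b}. \<Sum>q\<in>{..<b} \<times> {..<b}. cnj (x p) * limit_channel p q * x q) =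
    (\<Sum>a<b. \<Sum>c<b. \<Sum>c'<b. cnj (x (a, c)) * \<rho> $$ (c, c') * x (a, c'))"
proof -
  have "(\<Sum>p\<in>{..<b} \<times> {..<b}. \<Sum>q\<in>{..<b} \<times> {..<b}. cnj (x p) * limit_channel p q * x q) =
      (\<Sum>a<b. \<Sum>c<b. \<Sum>a'<b. \<Sum>c'<b. cnj (x (a, c)) * limit_channel (a, c) (a', c') * x (a', c'))"
    by (simp add: sum.cartesian_product')
  also have "\<dots> = (\<Sum>a<b. \<Sum>c<b. \<Sum>a'<b. if a' = a then \<Sum>c'<b. cnj (x (a, c)) * \<rho> $$ (c, c') * x (a', c') else 0)"
    by (rule sum.cong[OF refl], rule sum.cong[OF refl], rule sum.cong[OF refl]) (auto simp: limit_channel_def)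
  finally show ?thesis by simp
qed

text \<open>The Choi kernel of the limit is bounded below because \<open>\<rho>\<close> is nonsingular, so it absorbs an exponentially
  small error: up to a weight \<open>\<epsilon>\<close>, the map across a long gap forgets its input.\<close>

lemma gap_channel_dominates_limit:
  "\<exists>C \<mu>. 0 < C \<and> 0 < \<mu> \<and> \<mu> < 1 \<and> (\<forall>k. psd ({..<b} \<times> {..<b})
    (\<lambda>p q. gap_channel k p q - complex_of_real (1 - min 1 (C * \<mu> ^ k)) * limit_channel p q))"
proof -
  let ?J = "{..<b} \<times> {..<b}"
  obtain C \<mu> where C: "0 < C" and \<mu>: "0 < \<mu>" "\<mu> < 1"
    and decay: "\<And>k p q. p \<in> ?J \<Longrightarrow> q \<in> ?J \<Longrightarrow> cmod (gap_channel k p q - limit_channel p q) \<le> C * \<mu> ^ k"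
    using gap_channel_decay by blast
  obtain l where l: "0 < l"
    and co: "\<And>x. l * (\<Sum>r<b. (cmod (x r))\<^sup>2) \<le> Re (\<Sum>r<b. \<Sum>r'<b. cnj (x r) * \<rho> $$ (r, r') * x r')"
    using rho_coercive by blast
  have gap: "psd ?J (gap_channel k)" for k
  proof (rule psd_eq)
    show "psd ?J (\<lambda>p q. \<Sum>w<d ^ k. cnj (W k w (fst p) (snd p)) * cnj (cnj (W k w (fst q) (snd q))))"
      by (intro psd_sum psd_outer)
  qed (simp add: gap_channel_def)
  have coJ: "l * (\<Sum>p\<in>?J. (cmod (x p))\<^sup>2) \<le>
      Re (\<Sum>p\<in>?J. \<Sum>q\<in>?J. cnj (x p) * limit_channel p q * x q)" for x
  proof -
    have "l * (\<Sum>p\<in>?J. (cmod (x p))\<^sup>2) = (\<Sum>a<b. l * (\<Sum>c<b. (cmod (x (a, c)))\<^sup>2))"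
      by (simp add: sum.cartesian_product' sum_distrib_left)
    also have "\<dots> \<le> (\<Sum>a<b. Re (\<Sum>c<b. \<Sum>c'<b. cnj (x (a, c)) * \<rho> $$ (c, c') * x (a, c')))"
      by (intro sum_mono co)
    also have "\<dots> = Re (\<Sum>p\<in>?J. \<Sum>q\<in>?J. cnj (x p) * limit_channel p q * x q)"
      unfolding limit_channel_form Re_sum ..
    finally show ?thesis .
  qed
  have lim: "psd ?J limit_channel"
    unfolding psd_def limit_channel_form
    by (intro allI, rule sum_nonneg, rule rho_psd[unfolded psd_def, rule_format])
  \<comment> \<open>\<open>psd_perturbation\<close> with error \<open>C * \<mu> ^ k\<close> asks for
    a weight of at least \<open>C * \<mu> ^ k * card ?J / l\<close>.\<close>
  define C' where "C' = C * real (card ?J) / l"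
  have "b \<noteq> 0" using b_ge_1 by simp
  hence C': "0 < C'" using C l by (simp add: C'_def)
  have "psd ?J (\<lambda>p q. gap_channel k p q - complex_of_real (1 - min 1 (C' * \<mu> ^ k)) * limit_channel p q)" for k
  proof (cases "C' * \<mu> ^ k \<ge> 1")
    \<comment> \<open>Here the limit gets coefficient 0, and the gap channel is positive by
      itself.\<close>
    case True
    thus ?thesis using gap[of k] by (simp add: min_def)
  next
    case False
    have "psd ?J (\<lambda>p q. gap_channel k p q - complex_of_real (1 - C' * \<mu> ^ k) * limit_channel p q)"
    proof (rule psd_perturbation[OF gap lim decay _ coJ])
      show "C * \<mu> ^ k * real (card ?J) \<le> C' * \<mu> ^ k * l" using l by (simp add: C'_def)
    qed (use C C' \<mu> in auto)
    thus ?thesis using False by (simp add: min_def)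
  qed
  thus ?thesis using C' \<mu> by blast
qed

section \<open>From the memory channel to the entanglement of formation\<close>

lemma eof_gap_decay:
  "\<exists>C \<mu> :: real. 0 < C \<and> 0 < \<mu> \<and> \<mu> < 1 \<and> (\<forall>p n. 2 \<le> p \<and> p \<le> n \<longrightarrow>
    eof d (d ^ (n - p + 1)) (fcs_rho_gap d b V \<rho> p n) \<le> C * \<mu> ^ p)"
proof -
  obtain C \<mu> where C: "0 < C" and \<mu>: "0 < \<mu>" "\<mu> < 1"
    and H: "\<And>k. psd ({..<b} \<times> {..<b})
      (\<lambda>p q. gap_channel k p q - complex_of_real (1 - min 1 (C * \<mu> ^ k)) * limit_channel p q)"
    using gap_channel_dominates_limit by blast
  \<comment> \<open>The factor \<open>d\<close> is the entropy bound;
    \<open>1 / \<mu>\<^sup>2\<close> appears because the gap has \<open>p - 2\<close> sites.\<close>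
  have "eof d (d ^ (n - p + 1)) (fcs_rho_gap d b V \<rho> p n) \<le> C * real d / \<mu>\<^sup>2 * \<mu> ^ p"
    if p: "2 \<le> p" "p \<le> n" for p n
  proof -
    define k m where "k = p - 2" and "m = n - p + 1"
    \<comment> \<open>The cap at 1 keeps this a probability for short gaps; it stays positive, so
      \<open>\<tau>\<close> can be obtained by division.\<close>
    define \<epsilon> where "\<epsilon> = min 1 (C * \<mu> ^ k)"
    have \<epsilon>: "0 < \<epsilon>" "\<epsilon> \<le> 1" "\<epsilon> \<le> C * \<mu> ^ k" using C \<mu> by (auto simp: \<epsilon>_def)
    let ?c = "\<lambda>i j. chain_state 1 (i div d ^ m) (j div d ^ m) * chain_state m (i mod d ^ m) (j mod d ^ m)"
    define \<tau> where "\<tau> i j = complex_of_real (1 / \<epsilon>) *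
      (glue m (gap_channel k) i j - complex_of_real (1 - \<epsilon>) * ?c i j)" for i j
    have \<tau>: "psd {..<d * d ^ m} \<tau>"
      unfolding \<tau>_def glue_limit[symmetric] glue_diff[symmetric]
      by (intro psd_scale glue_psd) (use H[of k] \<epsilon> in \<open>auto simp: \<epsilon>_def\<close>)
    have tr1: "(\<Sum>i<d. chain_state 1 i i) = 1" using chain_state_trace[of 1] by simp
    have "(\<Sum>i<d * d ^ m. ?c i i) = (\<Sum>x<d. chain_state 1 x x) * (\<Sum>u<d ^ m. chain_state m u u)"
      unfolding sum_lessThan_mult sum_product by (intro sum.cong refl) auto
    hence "(\<Sum>i<d * d ^ m. ?c i i) = 1" by (simp only: tr1 chain_state_trace mult_1)
    \<comment> \<open>The glued state and the product state both have trace 1, so their weighted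
      difference has trace \<open>\<epsilon>\<close>.\<close>
    hence "(\<Sum>i<d * d ^ m. \<tau> i i) = complex_of_real (1 / \<epsilon>) * (1 - complex_of_real (1 - \<epsilon>) * 1)"
      unfolding \<tau>_def sum_distrib_left[symmetric] sum_subtractf by (simp only: glue_gap_trace)
    hence tr\<tau>: "(\<Sum>i<d * d ^ m. \<tau> i i) = 1" using \<epsilon> by simp
    have "fcs_rho_gap d b V \<rho> p n = mat (d * d ^ m) (d * d ^ m) (\<lambda>(i, j).
        complex_of_real (1 - \<epsilon>) * ?c i j + complex_of_real \<epsilon> * \<tau> i j)"
      unfolding fcs_rho_gap_eq[OF p] m_def[symmetric] k_def[symmetric]
      using \<epsilon> by (intro eq_matI) (auto simp: \<tau>_def)
    moreover have "eof d (d ^ m) \<dots> \<le> \<epsilon> * real d"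
      using \<epsilon> by (intro eof_mixture_with_product_le chain_state_psd tr1 chain_state_trace \<tau> tr\<tau>) auto
    ultimately have "eof d (d ^ m) (fcs_rho_gap d b V \<rho> p n) \<le> \<epsilon> * real d" by simp
    also have "\<dots> \<le> C * \<mu> ^ k * real d" using \<epsilon> by (intro mult_right_mono) auto
    also have "\<dots> = C * real d / \<mu>\<^sup>2 * \<mu> ^ p"
      using \<mu> p by (simp add: k_def power_diff)
    finally show ?thesis by (simp only: m_def)
  qed
  moreover have "0 < C * real d / \<mu>\<^sup>2" using C \<mu> d_ge_1 by simp
  ultimately show ?thesis using \<mu> by blast
qed

end

theorem theorem4:
  fixes d b :: nat and V \<rho> :: "complex mat"
  assumes "pure_fcs d b V \<rho>"
  shows "\<exists>C \<mu> :: real. 0 < C \<and> 0 < \<mu> \<and> \<mu> < 1 \<and>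
    (\<forall>p n :: nat. 2 \<le> p \<and> p \<le> n \<longrightarrow>
       eof d (d ^ (n - p + 1)) (fcs_rho_gap d b V \<rho> p n) \<le> C * \<mu> ^ p)"
  using pure_fcs.eof_gap_decay[OF assms] .

end
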